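(* For positive integers $L,M,N$ with at least one of them even, let $\mathrm{maxtw}(L,M,N)=\max\{\mathrm{Tw}(t): t \text{ a tiling of } [0,L]\times[0,M]\times[0,N]\}$. If $L,M,N\ge 2$, at least two of $L,M,N$ are strictly larger than $2$, and at least one of them is even, then $$C_0\,LMN\min(L,M,N)\le \mathrm{maxtw}(L,M,N)\le C_1\,LMN\min(L,M,N)$$ with $C_0=1/162$ and $C_1=1/16$. Moreover (limits taken over triples with at least one even entry), $$\limsup_{L,M,N\to\infty}\frac{\mathrm{maxtw}(L,M,N)}{LMN\min(L,M,N)}=\frac1{16},\qquad \liminf_{L,M,N\to\infty}\frac{\mathrm{maxtw}(L,M,N)}{LMN\min(L,M,N)}\le\frac1{24}.$$
   Context: A basic cube is $[x,x+1]\times[y,y+1]\times[z,z+1]$, $(x,y,z)\in\mathbb{Z}^3$; white if $x+y+z$ even, black if odd. A domino is the union of two basic cubes sharing a face; a tiling of a region (finite union of basic cubes) is a covering by dominoes with pairwise disjoint interiors. Let $\Phi=\{\pm e_x,\pm e_y,\pm e_z\}$. For a domino $d$, $v(d)\in\Phi$ is the center of its black cube minus the center of its white cube. For $X\subset\mathbb{R}^3$, $u\in\Phi$, $S^u(X)$ is the interior of $(X+[0,\infty)u)\setminus X$. For dominoes $d_0,d_1$: $\tau^u(d_0,d_1)=\tfrac14\det(v(d_1),v(d_0),u)$ if $d_1\cap S^u(d_0)\ne\emptyset$ and $0$ otherwise. For a tiling $t$, $T^u(t)=\sum_{d_0,d_1\in t}\tau^u(d_0,d_1)$ (ordered pairs).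 For a tiling $t$ of a box, $T^{e_x}(t)=T^{e_y}(t)=T^{e_z}(t)$ and this common value is the twist $\mathrm{Tw}(t)$. *)

theory Defs
  imports "HOL-Analysis.Analysis"
begin

(* A basic cube is addressed by its integer corner (x,y,z). *)

definition basic_cube :: "int ^ 3 \<Rightarrow> (real ^ 3) set" where
  "basic_cube p = cbox (\<chi> i. of_int (p $ i)) (\<chi> i. of_int (p $ i) + 1)"

definition cube_center :: "int ^ 3 \<Rightarrow> real ^ 3" where
  "cube_center p = (\<chi> i. of_int (p $ i) + 1 / 2)"

definition white :: "int ^ 3 \<Rightarrow> bool" where
  "white p \<longleftrightarrow> even (p $ 1 + p $ 2 + p $ 3)"

abbreviation black :: "int ^ 3 \<Rightarrow> bool" where
  "black p \<equiv> \<not> white p"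

(* "face" of a cube in the sense of a two-dimensional face, i.e. a facet *)
definition share_face :: "int ^ 3 \<Rightarrow> int ^ 3 \<Rightarrow> bool" where
  "share_face p q \<longleftrightarrow> p \<noteq> q \<and> (\<exists>F. F facet_of basic_cube p \<and> F facet_of basic_cube q)"

definition domino :: "(real ^ 3) set \<Rightarrow> bool" where
  "domino d \<longleftrightarrow> (\<exists>p q. share_face p q \<and> d = basic_cube p \<union> basic_cube q)"

definition tiling :: "(real ^ 3) set \<Rightarrow> (real ^ 3) set set \<Rightarrow> bool" where
  "tiling R t \<longleftrightarrow> (\<forall>d\<in>t. domino d) \<and> \<Union> t = R \<and>
     pairwise (\<lambda>d e. interior d \<inter> interior e = {}) t"

definition white_cube :: "(real ^ 3) set \<Rightarrow> int ^ 3" where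
  "white_cube d = (THE p. white p \<and> basic_cube p \<subseteq> d)"

definition black_cube :: "(real ^ 3) set \<Rightarrow> int ^ 3" where
  "black_cube d = (THE p. black p \<and> basic_cube p \<subseteq> d)"

definition domino_dir :: "(real ^ 3) set \<Rightarrow> real ^ 3" where
  "domino_dir d = cube_center (black_cube d) - cube_center (white_cube d)"

definition shade :: "real ^ 3 \<Rightarrow> (real ^ 3) set \<Rightarrow> (real ^ 3) set" where
  "shade u X = interior ({x + s *\<^sub>R u | x s. x \<in> X \<and> 0 \<le> s} - X)"

definition effect :: "real ^ 3 \<Rightarrow> (real ^ 3) set \<Rightarrow> (real ^ 3) set \<Rightarrow> real" where
  "effect u d0 d1 =
     (if d1 \<inter> shade u d0 \<noteq> {}
      then 1 / 4 * det (vector [domino_dir d1, domino_dir d0, u] :: real ^ 3 ^ 3) else 0)"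

definition pretwist :: "real ^ 3 \<Rightarrow> (real ^ 3) set set \<Rightarrow> real" where
  "pretwist u t = (\<Sum>(d0, d1) \<in> t \<times> t. effect u d0 d1)"

(* The common value of the pretwists along the three coordinate axes; only meaningful
   where these agree, as they do for tilings of boxes. *)
definition twist :: "(real ^ 3) set set \<Rightarrow> real" where
  "twist t = (THE c. \<forall>k. pretwist (axis k 1) t = c)"

definition lattice_box :: "nat \<Rightarrow> nat \<Rightarrow> nat \<Rightarrow> (real ^ 3) set" where
  "lattice_box L M N = cbox 0 (vector [real L, real M, real N])"

definition maxtw :: "nat \<Rightarrow> nat \<Rightarrow> nat \<Rightarrow> real" where
  "maxtw L M N = Max {twist t | t. tiling (lattice_box L M N) t}"

definition maxtw_ratio :: "nat \<Rightarrow> nat \<Rightarrow> nat \<Rightarrow> real" where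
  "maxtw_ratio L M N = maxtw L M N / real (L * M * N * min L (min M N))"

(* L, M, N tend to infinity jointly (and independently), along the triples with an even entry. *)
definition boxes_to_infinity :: "(nat \<times> nat \<times> nat) filter" where
  "boxes_to_infinity =
     inf (at_top \<times>\<^sub>F at_top \<times>\<^sub>F at_top) (principal {(L, M, N). even L \<or> even M \<or> even N})"

end

theory Submission
  imports Defs "HOL-Real_Asymp.Real_Asymp"
begin

text \<open>
  Orient every domino from its white to its black cube and let f be the resulting field of unit
  vectors on the cells. Then four times the pretwist along an axis is the sum, over the lines of
  cells in that direction, of the signed crossings of the two transversal components of f, a
  discrete helicity. As f comes from a flow on the edges of the lattice whose divergence is the
  colouring, summation by parts shows that the three axes give the same value.

  A line with p and q dominoes in the two transversal directions contributes at most p q, and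
  p + q is at most its length n, so that p q is bounded by n n / 4, and also by n (p + q) / 4;
  adding the last bound over the three axes of a cube gives 1/24.

  Conversely, take two parallel bars of cross section c times h and length l, joined at both ends
  by U-turns to a closed racetrack, and wrap a shell of thickness t around each bar. Racetrack and
  shells decompose into concentric rectangular rings of cells, each of which is a cycle with two
  perfect matchings; orienting the rings suitably, the racetrack is linked with both shells and the
  twist is l t c h. The sides of the box are 2 c + 4 t, l + 2 c and h + 2 t. Boxes with a side
  below 6 are cut into blocks of size 3, 3, 2, which have a tiling of twist 1.
\<close>

section \<open>Helicity of lattice flows\<close>

text \<open>The twist l t c h explains both lower constants. Over volume times height, the tubes
  reach l t c h / ((2 c + 4 t) (l + 2 c) (h + 2 t)^2). For h = 2 t, with c much larger than t and l
  much larger than c, this tends to 1/16: nearly every column is half shell and half core, which is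
  equality in p q <= n n / 4. In a cube of side 6 t, with c = t and l = h = 4 t, it is 1/81, so that
  1/162 leaves a factor two for rounding. Independence of the axis is more than well-definedness.
  The upper bound with the minimum needs lines in all three directions, while gluing boxes is
  harmless only across the lines that are summed over, so boxes are rotated freely between gluings.
  The combinatorics is therefore done first, for integer fields on cells and with four times the
  twist. The geometric definition with facets, interiors and shades is translated into it
  afterwards.\<close>

lemma sum_telescope_int:
  fixes f :: "int \<Rightarrow> 'a::ab_group_add"
  assumes "0 \<le> n"
  shows "(\<Sum>i\<in>{0..<n}. f i - f (i - 1)) = f (n - 1) - f (-1)"
  using assms
proof (induction n rule: int_ge_induct)
  case (step i)
  have "{0..<i+1} = insert i {0..<i}" using step by auto
  then show ?case using step by simp
qed simp

text \<open>With \<open>e j\<close> the flow through the face between cells \<open>j\<close> and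
  \<open>j + 1\<close>, the increments of \<open>j \<mapsto> sgn (j - i)\<close> are unit masses at
  the two faces of cell \<open>i\<close>. Summation by parts thus recovers the field at
  \<open>i\<close> from its divergence, and no boundary term remains.\<close>

lemma sum_by_parts_sgn:
  fixes e :: "int \<Rightarrow> int"
  assumes "e (-1) = 0" "e (n - 1) = 0" "i \<in> {0..<n}"
  shows "(\<Sum>j\<in>{0..<n}. sgn (j - i) * (e j - e (j - 1))) = - (e i + e (i - 1))"
proof -
  have "(\<Sum>j\<in>{0..<n}. sgn (j + 1 - i) * e j - sgn (j - 1 + 1 - i) * e (j - 1)) = 0"
    using sum_telescope_int[of n "\<lambda>j. sgn (j + 1 - i) * e j"] assms by simp
  then have *: "(\<Sum>j\<in>{0..<n}. sgn (j + 1 - i) * e j - sgn (j - i) * e (j - 1)) = 0"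
    by simp
  have "(\<Sum>j\<in>{0..<n}. sgn (j - i) * (e j - e (j - 1)))
      = (\<Sum>j\<in>{0..<n}. (sgn (j + 1 - i) * e j - sgn (j - i) * e (j - 1)) 
          - ((if j = i then e j else 0) + (if j = i - 1 then e j else 0)))"
    by (intro sum.cong) (auto simp: sgn_if algebra_simps)
  also have "\<dots> = - (e i + (\<Sum>j\<in>{0..<n}. if j = i - 1 then e j else 0))"
    using assms * by (simp add: sum_subtractf sum.distrib)
  also have "(\<Sum>j\<in>{0..<n}. if j = i - 1 then e j else 0) = e (i - 1)"
    using assms by (cases "i = 0") auto
  finally show ?thesis .
qed

lemma sum_Times: "(\<Sum>p\<in>A \<times> B. f (fst p) (snd p)) = (\<Sum>x\<in>A. \<Sum>y\<in>B. f x y)"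
  by (simp add: sum.cartesian_product case_prod_beta)

text \<open>Adding the sum with \<open>p\<close> and \<open>q\<close> exchanged turns the product
  into twice the increment of \<open>u p y * u q y\<close>, which telescopes in \<open>y\<close> to
  vanishing boundary values.\<close>

lemma skew_sum_zero:
  fixes u :: "'a \<Rightarrow> int \<Rightarrow> int" and S :: "'a \<Rightarrow> 'a \<Rightarrow> int"
  assumes "\<And>p. p \<in> P \<Longrightarrow> u p (-1) = 0" "\<And>p. p \<in> P \<Longrightarrow> u p (n - 1) = 0" "0 \<le> n"
    and sym: "\<And>p q. S p q = S q p"
  shows "(\<Sum>y\<in>{0..<n}. \<Sum>p\<in>P. \<Sum>q\<in>P. S p q * (u p y + u p (y - 1)) * (u q y - u q (y - 1))) = 0"
    (is "?T = 0")
proof -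
  have swap: "?T = (\<Sum>y\<in>{0..<n}. \<Sum>p\<in>P. \<Sum>q\<in>P. S p q * (u q y + u q (y - 1)) * (u p y - u p (y - 1)))"
    by (subst (2) sum.swap) (simp add: sym)
  have "?T + ?T = (\<Sum>y\<in>{0..<n}. \<Sum>p\<in>P. \<Sum>q\<in>P. 
      (2 * S p q) * (u p y * u q y - u p (y - 1) * u q (y - 1)))"
    by (subst (2) swap) (simp add: sum.distrib[symmetric] algebra_simps)
  also have "\<dots> = (\<Sum>p\<in>P. \<Sum>q\<in>P. \<Sum>y\<in>{0..<n}. 
      (2 * S p q) * (u p y * u q y - u p (y - 1) * u q (y - 1)))"
    by (subst sum.swap, rule sum.cong[OF refl], subst sum.swap, rule refl)
  also have "\<dots> = (\<Sum>p\<in>P. \<Sum>q\<in>P. (2 * S p q) * (\<Sum>y\<in>{0..<n}. 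
       u p y * u q y - u p (y - 1) * u q (y - 1)))"
    by (simp add: sum_distrib_left)
  also have "\<dots> = 0"
    using assms by (intro sum.neutral ballI) (simp add: sum_telescope_int[of n "\<lambda>y. u _ y * u _ y"])
  finally show ?thesis by simp
qed

text \<open>The sign change of \<open>\<kappa>\<close> turns the sum of neighbouring values into the
  increment of \<open>e y * \<kappa> y\<close>.\<close>

lemma alternating_sum_zero:
  fixes e \<kappa> :: "int \<Rightarrow> int"
  assumes "e (-1) = 0" "e (n - 1) = 0" "0 \<le> n" "\<And>y. \<kappa> (y + 1) = - \<kappa> y"
  shows "(\<Sum>y\<in>{0..<n}. (e y + e (y - 1)) * \<kappa> y) = 0"
proof -
  have "\<kappa> (y - 1) = - \<kappa> y" for y using assms(4)[of "y - 1"] by simp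
  then have "(\<Sum>y\<in>{0..<n}. (e y + e (y - 1)) * \<kappa> y) 
       = (\<Sum>y\<in>{0..<n}. e y * \<kappa> y - e (y - 1) * \<kappa> (y - 1))"
    by (simp add: algebra_simps)
  also have "\<dots> = 0" 
    using sum_telescope_int[of n "\<lambda>y. e y * \<kappa> y"] assms by simp
  finally show ?thesis .
qed

text \<open>The \<open>e\<close>s are flows through faces with divergence \<open>\<kappa>\<close>; a
  flow added to its predecessor is a component of the field at the cell. Both sides contain the y
  component \<open>G\<close>: the left pairs it with the potential \<open>A\<close> of the x
  component along z, the right with minus the potential \<open>C\<close> of the z component along x.
  So it suffices that \<open>G\<close> is orthogonal to \<open>A + C\<close>.\<close>

lemma helicity_axis_independent:
  fixes e1 e2 e3 \<kappa> :: "int \<Rightarrow> int \<Rightarrow> int \<Rightarrow> int" and L M N :: int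
  assumes "0 \<le> M"
    and div: "\<And>x y z. x \<in> {0..<L} \<Longrightarrow> y \<in> {0..<M} \<Longrightarrow> z \<in> {0..<N} \<Longrightarrow>
      (e1 x y z - e1 (x - 1) y z) + (e2 x y z - e2 x (y - 1) z) + (e3 x y z - e3 x y (z - 1)) = \<kappa> x y z"
    and e1: "\<And>y z. e1 (-1) y z = 0" "\<And>y z. e1 (L - 1) y z = 0"
    and e2: "\<And>x z. e2 x (-1) z = 0" "\<And>x z. e2 x (M - 1) z = 0"
    and e3: "\<And>x y. e3 x y (-1) = 0" "\<And>x y. e3 x y (N - 1) = 0"
    and \<kappa>: "\<And>x y z. \<kappa> x (y + 1) z = - \<kappa> x y z"
  shows "(\<Sum>x\<in>{0..<L}. \<Sum>y\<in>{0..<M}. \<Sum>z\<in>{0..<N}. \<Sum>z'\<in>{0..<N}.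
            sgn (z' - z) * (e1 x y z' + e1 (x - 1) y z') * (e2 x y z + e2 x (y - 1) z))
       = (\<Sum>y\<in>{0..<M}. \<Sum>z\<in>{0..<N}. \<Sum>x\<in>{0..<L}. \<Sum>x'\<in>{0..<L}.
            sgn (x' - x) * (e2 x' y z + e2 x' (y - 1) z) * (e3 x y z + e3 x y (z - 1)))"
    (is "?lhs = ?rhs")
proof -
  define G where "G x y z = e2 x y z + e2 x (y - 1) z" for x y z
  define F where "F x y z = e1 x y z + e1 (x - 1) y z" for x y z
  define H where "H x y z = e3 x y z + e3 x y (z - 1)" for x y z
  define A where "A x y z = (\<Sum>z'\<in>{0..<N}. sgn (z' - z) * F x y z')" for x y z
  define C where "C x y z = (\<Sum>x'\<in>{0..<L}. sgn (x' - x) * H x' y z)" for x y z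
  define P where "P = {0..<L} \<times> {0..<N}"
  define S where "S p q = sgn (fst q - fst p) * sgn (snd q - snd p)" for p q :: "int \<times> int"
  define u where "u p y = e2 (fst p) y (snd p)" for p y
  have lhs: "?lhs = (\<Sum>y\<in>{0..<M}. \<Sum>p\<in>P. G (fst p) y (snd p) * A (fst p) y (snd p))"
    unfolding P_def sum_Times[of "\<lambda>x z. G x _ z * A x _ z"]
    by (subst sum.swap) (simp add: A_def F_def G_def sum_distrib_left sum_distrib_right mult_ac)
  have rhs: "?rhs = - (\<Sum>y\<in>{0..<M}. \<Sum>p\<in>P. G (fst p) y (snd p) * C (fst p) y (snd p))"
  proof -
    have "?rhs = (\<Sum>y\<in>{0..<M}. \<Sum>z\<in>{0..<N}. \<Sum>x'\<in>{0..<L}. G x' y z * (- C x' y z))"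
    proof (rule sum.cong[OF refl], rule sum.cong[OF refl], goal_cases)
      case (1 y z)
      have "(\<Sum>x'\<in>{0..<L}. G x' y z * - C x' y z) = (\<Sum>x'\<in>{0..<L}. \<Sum>x\<in>{0..<L}. sgn (x' - x) * G x' y z * H x y z)"
        by (auto simp: C_def sum_distrib_left sum_negf[symmetric] sgn_if intro!: sum.cong)
      also have "\<dots> = (\<Sum>x\<in>{0..<L}. \<Sum>x'\<in>{0..<L}. sgn (x' - x) * G x' y z * H x y z)"
        by (rule sum.swap)
      finally show ?case by (simp add: G_def H_def)
    qed
    also have "\<dots> = (\<Sum>y\<in>{0..<M}. \<Sum>x'\<in>{0..<L}. \<Sum>z\<in>{0..<N}. G x' y z * (- C x' y z))"
      by (intro sum.cong refl sum.swap)
    finally show ?thesis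
      unfolding P_def sum_Times[of "\<lambda>x z. G x _ z * C x _ z"] by (simp add: sum_negf)
  qed
  \<comment> \<open>Within the plane of fixed \<open>y\<close>, the kernel \<open>S\<close> applied
    to the x part of the divergence gives \<open>- A\<close>, and applied to the z part gives
    \<open>- C\<close>. By \<open>div\<close> the two parts add up to \<open>\<kappa>\<close> minus
    the increment of \<open>e2\<close> in y.\<close>
  have AC: "A x y z + C x y z = - (\<Sum>q\<in>P. S (x, z) q * (\<kappa> (fst q) y (snd q) - (u q y - u q (y - 1))))"
    if xyz: "x \<in> {0..<L}" "y \<in> {0..<M}" "z \<in> {0..<N}" for x y z
  proof -
    have bp1: "(\<Sum>x'\<in>{0..<L}. sgn (x' - x) * (e1 x' y z' - e1 (x' - 1) y z')) = - F x y z'" for z'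
      using sum_by_parts_sgn[of "\<lambda>x. e1 x y z'" L x] xyz e1 by (simp add: F_def)
    have bp3: "(\<Sum>z'\<in>{0..<N}. sgn (z' - z) * (e3 x' y z' - e3 x' y (z' - 1))) = - H x' y z" for x'
      using sum_by_parts_sgn[of "\<lambda>z. e3 x' y z" N z] xyz e3 by (simp add: H_def)
    have "(\<Sum>q\<in>P. S (x, z) q * (\<kappa> (fst q) y (snd q) - (u q y - u q (y - 1)))) =
       (\<Sum>q\<in>P. S (x, z) q * ((e1 (fst q) y (snd q) - e1 (fst q - 1) y (snd q))))
       + (\<Sum>q\<in>P. S (x, z) q * ((e3 (fst q) y (snd q) - e3 (fst q) y (snd q - 1))))"
      unfolding sum.distrib[symmetric]
    proof (intro sum.cong refl)
      fix q assume "q \<in> P"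
      then have "\<kappa> (fst q) y (snd q) = (e1 (fst q) y (snd q) - e1 (fst q - 1) y (snd q)) 
        + (e2 (fst q) y (snd q) - e2 (fst q) (y - 1) (snd q)) 
        + (e3 (fst q) y (snd q) - e3 (fst q) y (snd q - 1))"
        using div[of "fst q" y "snd q"] xyz by (auto simp: P_def)
      then show "S (x, z) q * (\<kappa> (fst q) y (snd q) - (u q y - u q (y - 1))) =
          S (x, z) q * (e1 (fst q) y (snd q) - e1 (fst q - 1) y (snd q)) +
          S (x, z) q * (e3 (fst q) y (snd q) - e3 (fst q) y (snd q - 1))"
        by (simp add: u_def distrib_left[symmetric])
    qed
    also have "(\<Sum>q\<in>P. S (x, z) q * ((e1 (fst q) y (snd q) - e1 (fst q - 1) y (snd q)))) 
        = (\<Sum>z'\<in>{0..<N}. sgn (z' - z) * (\<Sum>x'\<in>{0..<L}. sgn (x' - x) * (e1 x' y z' - e1 (x' - 1) y z')))"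
      unfolding P_def S_def fst_conv snd_conv sum_Times[of "\<lambda>x' z'. sgn (x' - x) * sgn (z' - z) * (e1 x' y z' - e1 (x' - 1) y z')"]
      by (subst sum.swap) (simp add: sum_distrib_left mult_ac)
    also have "\<dots> = - A x y z"
      by (simp add: A_def bp1 sum_negf)
    also have "(\<Sum>q\<in>P. S (x, z) q * ((e3 (fst q) y (snd q) - e3 (fst q) y (snd q - 1)))) 
        = (\<Sum>x'\<in>{0..<L}. sgn (x' - x) * (\<Sum>z'\<in>{0..<N}. sgn (z' - z) * (e3 x' y z' - e3 x' y (z' - 1))))"
      unfolding P_def S_def fst_conv snd_conv sum_Times[of "\<lambda>x' z'. sgn (x' - x) * sgn (z' - z) * (e3 x' y z' - e3 x' y (z' - 1))"]
      by (simp add: sum_distrib_left mult_ac)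
    also have "\<dots> = - C x y z"
      by (simp add: C_def bp3 sum_negf)
    finally show ?thesis by simp
  qed
  have "?lhs - ?rhs = (\<Sum>y\<in>{0..<M}. \<Sum>p\<in>P. G (fst p) y (snd p) * (A (fst p) y (snd p) + C (fst p) y (snd p)))"
    unfolding lhs rhs by (simp add: sum.distrib[symmetric] distrib_left)
  also have "\<dots> = (\<Sum>y\<in>{0..<M}. \<Sum>p\<in>P. \<Sum>q\<in>P. S p q * (u p y + u p (y - 1)) * (u q y - u q (y - 1))
       - S p q * ((u p y + u p (y - 1)) * \<kappa> (fst q) y (snd q)))"
  proof (rule sum.cong[OF refl], rule sum.cong[OF refl], goal_cases)
    case (1 y p)
    then have *: "A (fst p) y (snd p) + C (fst p) y (snd p) 
      = - (\<Sum>q\<in>P. S p q * (\<kappa> (fst q) y (snd q) - (u q y - u q (y - 1))))"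
      using AC[of "fst p" y "snd p"] by (auto simp: P_def)
    show ?case
      unfolding * by (simp add: G_def u_def sum_distrib_left sum_negf[symmetric] algebra_simps)
  qed
  \<comment> \<open>The part quadratic in \<open>e2\<close> vanishes because \<open>S\<close> is
    symmetric; the part with \<open>\<kappa>\<close> vanishes below because \<open>\<kappa>\<close>
    alternates in y.\<close>
  also have "\<dots> = - (\<Sum>y\<in>{0..<M}. \<Sum>p\<in>P. \<Sum>q\<in>P. S p q * ((u p y + u p (y - 1)) * \<kappa> (fst q) y (snd q)))"
    unfolding sum_subtractf using assms(1) e2
    by (subst skew_sum_zero) (auto simp: u_def S_def sgn_if)
  also have "(\<Sum>y\<in>{0..<M}. \<Sum>p\<in>P. \<Sum>q\<in>P. S p q * ((u p y + u p (y - 1)) * \<kappa> (fst q) y (snd q)))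
     = (\<Sum>p\<in>P. \<Sum>q\<in>P. \<Sum>y\<in>{0..<M}. S p q * ((u p y + u p (y - 1)) * \<kappa> (fst q) y (snd q)))"
    by (subst sum.swap, rule sum.cong[OF refl], subst sum.swap, rule refl)
  also have "\<dots> = 0"
    unfolding sum_distrib_left[symmetric]
    by (intro sum.neutral ballI) (use assms(1) e2 \<kappa> alternating_sum_zero[of "u _" M "\<lambda>y. \<kappa> _ y _"] in \<open>simp add: u_def\<close>)
  finally show ?thesis by simp
qed

section \<open>Pairings of cells and their twist\<close>

definition in_box :: "int \<Rightarrow> int \<Rightarrow> int \<Rightarrow> int \<Rightarrow> int \<Rightarrow> int \<Rightarrow> bool" where
  "in_box L M N x y z \<longleftrightarrow> 0 \<le> x \<and> x < L \<and> 0 \<le> y \<and> y < M \<and> 0 \<le> z \<and> z < N"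

text \<open>A tiling is encoded by the map sending a cell to the step (a, b, c) towards its partner.\<close>

definition pairing :: "int \<Rightarrow> int \<Rightarrow> int \<Rightarrow> (int \<Rightarrow> int \<Rightarrow> int \<Rightarrow> int \<times> int \<times> int) \<Rightarrow> bool" where
  "pairing L M N w \<longleftrightarrow> (\<forall>x y z a b c. in_box L M N x y z \<and> w x y z = (a, b, c) \<longrightarrow>
     \<bar>a\<bar> + \<bar>b\<bar> + \<bar>c\<bar> = 1 \<and> in_box L M N (x + a) (y + b) (z + c) \<and>
     w (x + a) (y + b) (z + c) = (- a, - b, - c))"

definition colour :: "int \<Rightarrow> int" where
  "colour n = (if even n then 1 else - 1)"

lemma colour_simps [simp]:
  "colour n * colour n = 1" "colour n * (colour n * k) = k" "colour (n + 1) = - colour n" "colour (n - 1) = - colour n"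
  by (simp_all add: colour_def)

lemma colour_diff: "colour (m - n) = colour m * colour n"
  by (simp add: colour_def)

text \<open>
  The oriented domino at a cell is its step, multiplied by the colour of the cell; the product of
  two colours in a line only depends on the distance.
\<close>

definition column :: "int \<Rightarrow> (int \<Rightarrow> int \<Rightarrow> int \<Rightarrow> int \<times> int \<times> int) \<Rightarrow> int \<Rightarrow> int \<Rightarrow> int" where
  "column N w x y = (\<Sum>z\<in>{0..<N}. \<Sum>z'\<in>{0..<N}.
     sgn (z' - z) * colour (z' - z) * fst (w x y z') * fst (snd (w x y z)))"

definition ztwist :: "int \<Rightarrow> int \<Rightarrow> int \<Rightarrow> (int \<Rightarrow> int \<Rightarrow> int \<Rightarrow> int \<times> int \<times> int) \<Rightarrow> int" where
  "ztwist L M N w = (\<Sum>x\<in>{0..<L}. \<Sum>y\<in>{0..<M}. column N w x y)"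

text \<open>The old first axis becomes the third one, so \<open>ztwist\<close> of the rotated
  pairing is the twist along the old x direction.\<close>

definition cycle_axes :: "(int \<Rightarrow> int \<Rightarrow> int \<Rightarrow> int \<times> int \<times> int) \<Rightarrow> (int \<Rightarrow> int \<Rightarrow> int \<Rightarrow> int \<times> int \<times> int)" where
  "cycle_axes w x y z = (case w z x y of (a, b, c) \<Rightarrow> (b, c, a))"

lemma pairingD:
  assumes "pairing L M N w" "in_box L M N x y z" "w x y z = (a, b, c)"
  shows "\<bar>a\<bar> + \<bar>b\<bar> + \<bar>c\<bar> = 1" "in_box L M N (x + a) (y + b) (z + c)"
    "w (x + a) (y + b) (z + c) = (- a, - b, - c)"
  using assms unfolding pairing_def by blast+

lemma unit_step_cases:
  fixes a b c :: int
  assumes "\<bar>a\<bar> + \<bar>b\<bar> + \<bar>c\<bar> = 1"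
  shows "(a, b, c) \<in> {(1,0,0), (-1,0,0), (0,1,0), (0,-1,0), (0,0,1), (0,0,-1)}"
proof -
  have "a = -1 \<or> a = 0 \<or> a = 1" "b = -1 \<or> b = 0 \<or> b = 1" "c = -1 \<or> c = 0 \<or> c = 1"
    using assms by linarith+
  then show ?thesis using assms by (elim disjE) simp_all
qed

lemma pairing_cycle_axes:
  assumes "pairing L M N w"
  shows "pairing M N L (cycle_axes w)"
  unfolding pairing_def
proof (intro allI impI, elim conjE)
  fix x y z a b c
  assume "in_box M N L x y z" and w: "cycle_axes w x y z = (a, b, c)"
  then have "in_box L M N z x y" "w z x y = (c, a, b)"
    by (auto simp: in_box_def cycle_axes_def split: prod.splits)
  from pairingD[OF assms this] 
  show "\<bar>a\<bar> + \<bar>b\<bar> + \<bar>c\<bar> = 1 \<and> in_box M N L (x + a) (y + b) (z + c) \<and>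
       cycle_axes w (x + a) (y + b) (z + c) = (- a, - b, - c)"
    by (auto simp: in_box_def cycle_axes_def)
qed

lemma ztwist_cycle_axes:
  assumes w: "pairing L M N w" and nn: "0 \<le> M"
  shows "ztwist M N L (cycle_axes w) = ztwist L M N w"
proof -
  \<comment> \<open>Flow through the face towards the successor, counted in the direction of the
    axis: a white cell stepping forwards sends 1, while a black one is entered from its successor,
    hence -1. The facts \<open>e1'\<close>, \<open>e2'\<close>, \<open>e3'\<close> read the flow
    through the opposite face off the backward step of the cell itself.\<close>
  define e1 where "e1 x y z = (if in_box L M N x y z \<and> fst (w x y z) = 1 then colour (x + y + z) else 0)" for x y z
  define e2 where "e2 x y z = (if in_box L M N x y z \<and> fst (snd (w x y z)) = 1 then colour (x + y + z) else 0)" for x y z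
  define e3 where "e3 x y z = (if in_box L M N x y z \<and> snd (snd (w x y z)) = 1 then colour (x + y + z) else 0)" for x y z
  note D = pairingD[OF w]
  have pred: "in_box L M N (x - a) (y - b) (z - c) \<and> w (x - a) (y - b) (z - c) = (a, b, c)"
    if "in_box L M N x y z" "w x y z = (- a, - b, - c)" for x y z a b c
    using D(2,3)[OF that] by simp
  have unit: "w x y z \<in> {(1,0,0), (-1,0,0), (0,1,0), (0,-1,0), (0,0,1), (0,0,-1)}"
    if "in_box L M N x y z" for x y z
    using unit_step_cases[of "fst (w x y z)" "fst (snd (w x y z))" "snd (snd (w x y z))"]
      D(1)[OF that, of "fst (w x y z)" "fst (snd (w x y z))" "snd (snd (w x y z))"] by simp
  have e1': "e1 (x - 1) y z = (if fst (w x y z) = - 1 then - colour (x + y + z) else 0)" 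
    if "in_box L M N x y z" for x y z
  proof (cases "fst (w x y z) = - 1")
    case True
    then have "w x y z = (- 1, - 0, - 0)" using unit[OF that] by auto
    from pred[OF that this] show ?thesis using True by (auto simp: e1_def colour_def)
  next
    case False
    have "\<not> (in_box L M N (x - 1) y z \<and> fst (w (x - 1) y z) = 1)"
    proof
      assume *: "in_box L M N (x - 1) y z \<and> fst (w (x - 1) y z) = 1"
      then have "w (x - 1) y z = (1, 0, 0)" using unit[of "x - 1" y z] by auto
      from D(3)[OF conjunct1[OF *] this] False show False by simp
    qed
    then show ?thesis using False by (auto simp: e1_def)
  qed
  have e2': "e2 x (y - 1) z = (if fst (snd (w x y z)) = - 1 then - colour (x + y + z) else 0)" 
    if "in_box L M N x y z" for x y z
  proof (cases "fst (snd (w x y z)) = - 1")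
    case True
    then have "w x y z = (- 0, - 1, - 0)" using unit[OF that] by auto
    from pred[OF that this] show ?thesis using True by (auto simp: e2_def colour_def)
  next
    case False
    have "\<not> (in_box L M N x (y - 1) z \<and> fst (snd (w x (y - 1) z)) = 1)"
    proof
      assume *: "in_box L M N x (y - 1) z \<and> fst (snd (w x (y - 1) z)) = 1"
      then have "w x (y - 1) z = (0, 1, 0)" using unit[of x "y - 1" z] by auto
      from D(3)[OF conjunct1[OF *] this] False show False by simp
    qed
    then show ?thesis using False by (auto simp: e2_def)
  qed
  have e3': "e3 x y (z - 1) = (if snd (snd (w x y z)) = - 1 then - colour (x + y + z) else 0)" 
    if "in_box L M N x y z" for x y z
  proof (cases "snd (snd (w x y z)) = - 1")
    case True
    then have "w x y z = (- 0, - 0, - 1)" using unit[OF that] by auto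
    from pred[OF that this] show ?thesis using True by (auto simp: e3_def colour_def)
  next
    case False
    have "\<not> (in_box L M N x y (z - 1) \<and> snd (snd (w x y (z - 1))) = 1)"
    proof
      assume *: "in_box L M N x y (z - 1) \<and> snd (snd (w x y (z - 1))) = 1"
      then have "w x y (z - 1) = (0, 0, 1)" using unit[of x y "z - 1"] by auto
      from D(3)[OF conjunct1[OF *] this] False show False by simp
    qed
    then show ?thesis using False by (auto simp: e3_def)
  qed
  have 1: "e1 x y z + e1 (x - 1) y z = colour (x + y + z) * fst (w x y z)"
    and 2: "e2 x y z + e2 x (y - 1) z = colour (x + y + z) * fst (snd (w x y z))"
    and 3: "e3 x y z + e3 x y (z - 1) = colour (x + y + z) * snd (snd (w x y z))"
    and div: "(e1 x y z - e1 (x - 1) y z) + (e2 x y z - e2 x (y - 1) z) + (e3 x y z - e3 x y (z - 1)) = colour (x + y + z)"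
    if "x \<in> {0..<L}" "y \<in> {0..<M}" "z \<in> {0..<N}" for x y z
  proof -
    have b: "in_box L M N x y z" using that by (simp add: in_box_def)
    show "e1 x y z + e1 (x - 1) y z = colour (x + y + z) * fst (w x y z)"
      "e2 x y z + e2 x (y - 1) z = colour (x + y + z) * fst (snd (w x y z))"
      "e3 x y z + e3 x y (z - 1) = colour (x + y + z) * snd (snd (w x y z))"
      "(e1 x y z - e1 (x - 1) y z) + (e2 x y z - e2 x (y - 1) z) + (e3 x y z - e3 x y (z - 1)) = colour (x + y + z)"
      using unit[OF b] unfolding e1'[OF b] e2'[OF b] e3'[OF b] unfolding e1_def e2_def e3_def
      by (simp_all add: b) (elim disjE; simp)+
  qed
  have edge: "\<not> in_box L M N (-1) y z" "\<not> in_box L M N x (-1) z" "\<not> in_box L M N x y (-1)" 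
    "\<not> in_box L M N L y z" "\<not> in_box L M N x M z" "\<not> in_box L M N x y N" for x y z
    by (auto simp: in_box_def)
  have end1: "e1 (L - 1) y z = 0" for y z
  proof (rule ccontr)
    assume "e1 (L - 1) y z \<noteq> 0"
    then have *: "in_box L M N (L - 1) y z \<and> fst (w (L - 1) y z) = 1"
      unfolding e1_def by (metis (full_types))
    then have "w (L - 1) y z = (1, 0, 0)" using unit[of "L - 1" y z] by auto
    from D(2)[OF conjunct1[OF *] this] show False using edge by simp
  qed
  have end2: "e2 x (M - 1) z = 0" for x z
  proof (rule ccontr)
    assume "e2 x (M - 1) z \<noteq> 0"
    then have *: "in_box L M N x (M - 1) z \<and> fst (snd (w x (M - 1) z)) = 1"
      unfolding e2_def by (metis (full_types))
    then have "w x (M - 1) z = (0, 1, 0)" using unit[of x "M - 1" z] by auto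
    from D(2)[OF conjunct1[OF *] this] show False using edge by simp
  qed
  have end3: "e3 x y (N - 1) = 0" for x y
  proof (rule ccontr)
    assume "e3 x y (N - 1) \<noteq> 0"
    then have *: "in_box L M N x y (N - 1) \<and> snd (snd (w x y (N - 1))) = 1"
      unfolding e3_def by (metis (full_types))
    then have "w x y (N - 1) = (0, 0, 1)" using unit[of x y "N - 1"] by auto
    from D(2)[OF conjunct1[OF *] this] show False using edge by simp
  qed
  have start: "e1 (-1) y z = 0" "e2 x (-1) z = 0" "e3 x y (-1) = 0" for x y z
    by (simp_all add: e1_def e2_def e3_def edge)
  have col: "colour (x + y + z) = colour (x + z + y)" "colour (x + (y + 1) + z) = - colour (x + y + z)" for x y z
    by (auto simp: colour_def)
  have zz: "sgn (z' - z) * colour (z' - z) * a * b 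
      = sgn (z' - z) * (colour (x + y + z') * a) * (colour (x + y + z) * b)" for z z' x y a b
    by (simp add: colour_def)
  have xx: "sgn (x' - x) * colour (x' - x) * a * b 
      = sgn (x' - x) * (colour (x' + y + z) * a) * (colour (x + y + z) * b)" for z x' x y a b
    by (auto simp: colour_def)
  have "ztwist L M N w = (\<Sum>x\<in>{0..<L}. \<Sum>y\<in>{0..<M}. \<Sum>z\<in>{0..<N}. \<Sum>z'\<in>{0..<N}.
            sgn (z' - z) * (e1 x y z' + e1 (x - 1) y z') * (e2 x y z + e2 x (y - 1) z))"
    unfolding ztwist_def column_def
    by (intro sum.cong refl, subst 1, simp, simp, simp, subst 2, simp, simp, simp, rule zz)
  also have "\<dots> = (\<Sum>y\<in>{0..<M}. \<Sum>z\<in>{0..<N}. \<Sum>x\<in>{0..<L}. \<Sum>x'\<in>{0..<L}.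
            sgn (x' - x) * (e2 x' y z + e2 x' (y - 1) z) * (e3 x y z + e3 x y (z - 1)))"
    by (rule helicity_axis_independent[where \<kappa> = "\<lambda>x y z. colour (x + y + z)"])
      (use nn div start end1 end2 end3 col in auto)
  also have "\<dots> = ztwist M N L (cycle_axes w)"
    unfolding ztwist_def column_def
    apply (intro sum.cong refl, subst 2, simp, simp, simp, subst 3, simp, simp, simp)
    apply (simp only: xx[symmetric])
    by (simp add: cycle_axes_def split: prod.splits)
  finally show ?thesis by simp
qed

section \<open>Upper bounds, and gluing of boxes\<close>

lemma column_bound:
  assumes w: "pairing L M N w" and x: "x \<in> {0..<L}" and y: "y \<in> {0..<M}" and N: "0 \<le> N"
  shows "4 * column N w x y \<le> N * (\<Sum>z\<in>{0..<N}. \<bar>fst (w x y z)\<bar> + \<bar>fst (snd (w x y z))\<bar>)"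
    and "4 * column N w x y \<le> N * N"
proof -
  define p q where "p = (\<Sum>z\<in>{0..<N}. \<bar>fst (w x y z)\<bar>)" and "q = (\<Sum>z\<in>{0..<N}. \<bar>fst (snd (w x y z))\<bar>)"
  have "column N w x y \<le> (\<Sum>z\<in>{0..<N}. \<Sum>z'\<in>{0..<N}. \<bar>fst (w x y z')\<bar> * \<bar>fst (snd (w x y z))\<bar>)"
    unfolding column_def by (intro sum_mono) (auto simp: sgn_if colour_def abs_mult[symmetric])
  also have "\<dots> = p * q"
    by (simp add: p_def q_def sum_product mult.commute) (rule sum.swap)
  finally have le: "column N w x y \<le> p * q" .
  have "p + q \<le> (\<Sum>z\<in>{0..<N}. 1)"
    unfolding p_def q_def sum.distrib[symmetric]
  proof (rule sum_mono)
    fix z assume "z \<in> {0..<N}"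
    then have "in_box L M N x y z" using x y by (simp add: in_box_def)
    from pairingD(1)[OF w this, of "fst (w x y z)" "fst (snd (w x y z))" "snd (snd (w x y z))"]
    show "\<bar>fst (w x y z)\<bar> + \<bar>fst (snd (w x y z))\<bar> \<le> 1" by simp
  qed
  then have s: "p + q \<le> N" using N by simp
  have s0: "0 \<le> p + q" by (simp add: p_def q_def sum_nonneg)
  have "4 * (p * q) \<le> (p + q) * (p + q)"
    using zero_le_square[of "p - q"] by (simp add: algebra_simps)
  also have "\<dots> \<le> N * (p + q)" using s s0 by (intro mult_right_mono) auto
  finally have "4 * column N w x y \<le> N * (p + q)" using le by simp
  moreover have "N * (p + q) \<le> N * N" using s N by (intro mult_left_mono)
  ultimately show "4 * column N w x y \<le> N * (\<Sum>z\<in>{0..<N}. \<bar>fst (w x y z)\<bar> + \<bar>fst (snd (w x y z))\<bar>)"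
    and "4 * column N w x y \<le> N * N" by (auto simp: p_def q_def sum.distrib)
qed

lemma ztwist_upper:
  assumes "pairing L M N w" "0 \<le> L" "0 \<le> M" "0 \<le> N"
  shows "4 * ztwist L M N w \<le> L * M * (N * N)"
proof -
  have "4 * ztwist L M N w \<le> (\<Sum>x\<in>{0..<L}. \<Sum>y\<in>{0..<M}. N * N)"
    unfolding ztwist_def sum_distrib_left using assms by (intro sum_mono column_bound)
  then show ?thesis using assms by simp
qed

text \<open>The domino at a cell is transversal to exactly two axes. Adding
  \<open>column_bound\<close> over the three axes, whose twists agree, hence counts every cell
  twice: 12 times \<open>ztwist\<close> is at most \<open>n\<close> times twice the volume.\<close>

lemma ztwist_upper_cube:
  assumes w: "pairing n n n w" and n: "0 \<le> n"
  shows "6 * ztwist n n n w \<le> n * n * n * n"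
proof -
  define S where "S f = (\<Sum>x\<in>{0..<n}. \<Sum>y\<in>{0..<n}. \<Sum>z\<in>{0..<n}. f x y z)" for f :: "int \<Rightarrow> int \<Rightarrow> int \<Rightarrow> int"
  define a where "a x y z = \<bar>fst (w x y z)\<bar>" for x y z
  define b where "b x y z = \<bar>fst (snd (w x y z))\<bar>" for x y z
  define c where "c x y z = \<bar>snd (snd (w x y z))\<bar>" for x y z
  have B: "4 * ztwist n n n v \<le> n * S (\<lambda>x y z. \<bar>fst (v x y z)\<bar> + \<bar>fst (snd (v x y z))\<bar>)"
    if "pairing n n n v" for v
  proof -
    have "(\<Sum>x\<in>{0..<n}. \<Sum>y\<in>{0..<n}. 4 * column n v x y)
      \<le> (\<Sum>x\<in>{0..<n}. \<Sum>y\<in>{0..<n}. n * (\<Sum>z\<in>{0..<n}. \<bar>fst (v x y z)\<bar> + \<bar>fst (snd (v x y z))\<bar>))"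
      using that n by (intro sum_mono column_bound)
    then show ?thesis by (simp only: ztwist_def sum_distrib_left S_def)
  qed
  have cyc: "S (\<lambda>x y z. f z x y) = S f" for f
  proof -
    have "S (\<lambda>x y z. f z x y) = (\<Sum>x\<in>{0..<n}. \<Sum>z\<in>{0..<n}. \<Sum>y\<in>{0..<n}. f z x y)"
      unfolding S_def by (intro sum.cong refl sum.swap)
    also have "\<dots> = S f" unfolding S_def by (rule sum.swap)
    finally show ?thesis .
  qed
  have w1: "pairing n n n (cycle_axes w)" and w2: "pairing n n n (cycle_axes (cycle_axes w))"
    using w by (simp_all add: pairing_cycle_axes)
  have t: "ztwist n n n (cycle_axes w) = ztwist n n n w" "ztwist n n n (cycle_axes (cycle_axes w)) = ztwist n n n w"
    using ztwist_cycle_axes[OF w n] ztwist_cycle_axes[OF w1 n] by simp_all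
  have "S (\<lambda>x y z. \<bar>fst (cycle_axes w x y z)\<bar> + \<bar>fst (snd (cycle_axes w x y z))\<bar>) = S (\<lambda>x y z. b x y z + c x y z)"
    using cyc[of "\<lambda>x y z. b x y z + c x y z"] by (simp add: cycle_axes_def b_def c_def case_prod_beta)
  moreover have "S (\<lambda>x y z. \<bar>fst (cycle_axes (cycle_axes w) x y z)\<bar> + \<bar>fst (snd (cycle_axes (cycle_axes w) x y z))\<bar>)
     = S (\<lambda>x y z. c x y z + a x y z)"
    using cyc[of "\<lambda>x y z. c z x y + a z x y"] cyc[of "\<lambda>x y z. c x y z + a x y z"] 
    by (simp add: cycle_axes_def a_def c_def case_prod_beta)
  moreover have "S (\<lambda>x y z. \<bar>fst (w x y z)\<bar> + \<bar>fst (snd (w x y z))\<bar>) = S (\<lambda>x y z. a x y z + b x y z)"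
    by (simp add: a_def b_def)
  ultimately have "12 * ztwist n n n w \<le> n * (2 * S (\<lambda>x y z. a x y z + b x y z + c x y z))"
    using B[OF w] B[OF w1] B[OF w2] unfolding t by (simp add: S_def sum.distrib algebra_simps)
  also have "S (\<lambda>x y z. a x y z + b x y z + c x y z) = S (\<lambda>x y z. 1)"
    unfolding S_def
  proof (rule sum.cong[OF refl], rule sum.cong[OF refl], rule sum.cong[OF refl])
    fix x y z assume "x \<in> {0..<n}" "y \<in> {0..<n}" "z \<in> {0..<n}"
    then have "in_box n n n x y z" by (simp add: in_box_def)
    from pairingD(1)[OF w this, of "fst (w x y z)" "fst (snd (w x y z))" "snd (snd (w x y z))"]
    show "a x y z + b x y z + c x y z = 1" by (simp add: a_def b_def c_def)
  qed
  also have "\<dots> = n * n * n" using n by (simp add: S_def)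
  finally show ?thesis by simp
qed

text \<open>The value \<open>k\<close> is a lower bound for four times a twist, the scale of
  \<open>ztwist\<close>; a block of twist 1 appears with \<open>k = 4\<close>.\<close>

definition attains :: "nat \<Rightarrow> nat \<Rightarrow> nat \<Rightarrow> int \<Rightarrow> bool" where
  "attains L M N k \<longleftrightarrow> (\<exists>w. pairing (int L) (int M) (int N) w \<and> k \<le> ztwist (int L) (int M) (int N) w)"



section \<open>Rotating, gluing and padding boxes\<close>

lemma attains_cycle: "attains L M N k \<Longrightarrow> attains M N L k"
  unfolding attains_def by (metis pairing_cycle_axes ztwist_cycle_axes of_nat_0_le_iff)

lemma reflect_sum: "(\<Sum>i\<in>{0..<n}. f (n - 1 - i)) = (\<Sum>i\<in>{0..<n::int}. f i)"
  by (rule sum.reindex_bij_witness[of _ "\<lambda>i. n - 1 - i" "\<lambda>i. n - 1 - i"]) auto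

lemma attains_swap:
  assumes "attains L M N k"
  shows "attains M L N k"
proof -
  from assms obtain w where w: "pairing (int L) (int M) (int N) w" and k: "k \<le> ztwist (int L) (int M) (int N) w"
    by (auto simp: attains_def)
  \<comment> \<open>A quarter turn: a mere exchange of two axes would reverse the sign of the twist.\<close>
  define v where "v x y z = (case w (int L - 1 - y) x z of (a, b, c) \<Rightarrow> (b, - a, c))" for x y z
  have "pairing (int M) (int L) (int N) v"
    unfolding pairing_def
  proof (intro allI impI, elim conjE)
    fix x y z a b c
    assume *: "in_box (int M) (int L) (int N) x y z" "v x y z = (a, b, c)"
    then have b: "in_box (int L) (int M) (int N) (int L - 1 - y) x z" 
      and e: "w (int L - 1 - y) x z = (- b, a, c)"
      by (auto simp: in_box_def v_def split: prod.splits)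
    have 1: "int L - 1 - (y + b) = int L - 1 - y + - b" by simp
    from pairingD[OF w b e]
    show "\<bar>a\<bar> + \<bar>b\<bar> + \<bar>c\<bar> = 1 \<and> in_box (int M) (int L) (int N) (x + a) (y + b) (z + c) \<and>
       v (x + a) (y + b) (z + c) = (- a, - b, - c)"
      unfolding v_def 1 by (auto simp: in_box_def)
  qed
  \<comment> \<open>The turned components are \<open>(b, - a)\<close>. The sign of
    \<open>- a\<close> is compensated by that of \<open>sgn\<close> when \<open>z\<close> and
    \<open>z'\<close> are exchanged.\<close>
  moreover have "column (int N) v x y = column (int N) w (int L - 1 - y) x" for x y
    unfolding column_def
    by (subst sum.swap) (auto intro!: sum.cong simp: v_def case_prod_beta sgn_if colour_def)
  then have "ztwist (int M) (int L) (int N) v = ztwist (int L) (int M) (int N) w"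
    unfolding ztwist_def by (simp add: reflect_sum[of "\<lambda>y. column _ w y _"] sum.swap[of _ "{0..<int L}"])
  ultimately show ?thesis using k unfolding attains_def by auto
qed

text \<open>The boxes are glued along x, so every z-column lies inside one of them and there are no
  mixed terms.\<close>

lemma attains_append:
  assumes "attains L M N k" "attains L' M N k'"
  shows "attains (L + L') M N (k + k')"
proof -
  from assms obtain w w' where w: "pairing (int L) (int M) (int N) w" "k \<le> ztwist (int L) (int M) (int N) w"
    and w': "pairing (int L') (int M) (int N) w'" "k' \<le> ztwist (int L') (int M) (int N) w'"
    by (auto simp: attains_def)
  define v where "v x y z = (if x < int L then w x y z else w' (x - int L) y z)" for x y z
  have "pairing (int (L + L')) (int M) (int N) v"
    unfolding pairing_def
  proof (intro allI impI, elim conjE)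
    fix x y z a b c
    assume *: "in_box (int (L + L')) (int M) (int N) x y z" "v x y z = (a, b, c)"
    show "\<bar>a\<bar> + \<bar>b\<bar> + \<bar>c\<bar> = 1 \<and> in_box (int (L + L')) (int M) (int N) (x + a) (y + b) (z + c) \<and>
       v (x + a) (y + b) (z + c) = (- a, - b, - c)"
    proof (cases "x < int L")
      case True
      then have "in_box (int L) (int M) (int N) x y z" "w x y z = (a, b, c)"
        using * by (auto simp: v_def in_box_def)
      from pairingD[OF w(1) this] show ?thesis by (auto simp: v_def in_box_def)
    next
      case False
      then have "in_box (int L') (int M) (int N) (x - int L) y z" "w' (x - int L) y z = (a, b, c)"
        using * by (auto simp: v_def in_box_def)
      from pairingD[OF w'(1) this] show ?thesis by (auto simp: v_def in_box_def algebra_simps)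
    qed
  qed
  moreover have "ztwist (int (L + L')) (int M) (int N) v = ztwist (int L) (int M) (int N) w + ztwist (int L') (int M) (int N) w'"
  proof -
    have col: "column (int N) v x y = (if x < int L then column (int N) w x y else column (int N) w' (x - int L) y)" for x y
      by (simp add: column_def v_def)
    have "{0..<int (L + L')} = {0..<int L} \<union> {int L..<int (L + L')}" by auto
    then have "ztwist (int (L + L')) (int M) (int N) v 
      = (\<Sum>x\<in>{0..<int L}. \<Sum>y\<in>{0..<int M}. column (int N) v x y) + (\<Sum>x\<in>{int L..<int (L + L')}. \<Sum>y\<in>{0..<int M}. column (int N) v x y)"
      unfolding ztwist_def by (simp add: sum.union_disjoint)
    also have "(\<Sum>x\<in>{0..<int L}. \<Sum>y\<in>{0..<int M}. column (int N) v x y) = ztwist (int L) (int M) (int N) w"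
      unfolding ztwist_def by (intro sum.cong refl) (simp add: col)
    also have "(\<Sum>x\<in>{int L..<int (L + L')}. \<Sum>y\<in>{0..<int M}. column (int N) v x y) = ztwist (int L') (int M) (int N) w'"
      unfolding ztwist_def
      by (rule sum.reindex_bij_witness[of _ "\<lambda>x. x + int L" "\<lambda>x. x - int L"]) (auto simp: col)
    finally show ?thesis .
  qed
  ultimately show ?thesis using w(2) w'(2) unfolding attains_def by force
qed

text \<open>With all dominoes parallel to an even side, one factor of each crossing vanishes. This
  is the filler for leftover space.\<close>

lemma attains_zero:
  assumes "even (L * M * N)"
  shows "attains L M N 0"
proof -
  have *: "attains L M N 0" if "even L" for L M N
  proof -
    define w :: "int \<Rightarrow> int \<Rightarrow> int \<Rightarrow> int \<times> int \<times> int" where "w x y z = (if even x then (1, 0, 0) else (-1, 0, 0))" for x y z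
    have "pairing (int L) (int M) (int N) w"
      unfolding pairing_def
    proof (intro allI impI, elim conjE)
      fix x y z a b c
      assume *: "in_box (int L) (int M) (int N) x y z" "w x y z = (a, b, c)"
      have "even x \<Longrightarrow> x \<noteq> int L - 1" "odd x \<Longrightarrow> x \<noteq> 0" using that by auto
      then show "\<bar>a\<bar> + \<bar>b\<bar> + \<bar>c\<bar> = 1 \<and> in_box (int L) (int M) (int N) (x + a) (y + b) (z + c) \<and>
         w (x + a) (y + b) (z + c) = (- a, - b, - c)"
        using * by (auto simp: w_def in_box_def split: if_splits)
    qed
    moreover have "ztwist (int L) (int M) (int N) w = 0"
      by (auto simp: ztwist_def column_def w_def intro!: sum.neutral)
    ultimately show ?thesis unfolding attains_def by auto
  qed
  from assms consider "even L" | "even M" | "even N" by auto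
  then show ?thesis
    using *[of L M N] *[of M N L, THEN attains_cycle, THEN attains_cycle] *[of N L M, THEN attains_cycle]
    by cases
qed

section \<open>Concentric rings\<close>

text \<open>
  The rectangle of size A times B is cut into concentric rings, run through counterclockwise;
  \<open>ring_out\<close> is the step leaving a cell, \<open>ring_in\<close> the step entering it. They differ
  at the corners.
\<close>

definition ring_out :: "int \<Rightarrow> int \<Rightarrow> int \<Rightarrow> int \<Rightarrow> int \<times> int" where
  "ring_out A B x y =
    (if y \<le> x \<and> x < A - 1 - y \<and> y \<le> B - 1 - y then (1, 0)
     else if A - 1 - x \<le> y \<and> y < B - A + x \<and> A - 1 - x \<le> x then (0, 1)
     else if B - 1 - y < x \<and> x \<le> A - B + y \<and> B - 1 - y \<le> y then (-1, 0)
     else (0, -1))"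

definition ring_in :: "int \<Rightarrow> int \<Rightarrow> int \<Rightarrow> int \<Rightarrow> int \<times> int" where
  "ring_in A B x y =
    (if y < x \<and> x \<le> A - 1 - y \<and> y \<le> B - 1 - y then (1, 0)
     else if A - 1 - x < y \<and> y \<le> B - A + x \<and> A - 1 - x \<le> x then (0, 1)
     else if B - 1 - y \<le> x \<and> x < A - B + y \<and> B - 1 - y \<le> y then (-1, 0)
     else (0, -1))"

text \<open>Cells of even \<open>x + y + p\<close> are matched forwards along their ring and the
  others backwards. Multiplied by \<open>colour (x + y + p)\<close>, every step therefore points
  counterclockwise. Replacing \<open>p\<close> by \<open>p + 1\<close> selects the other matching,
  which reverses the flow with respect to a fixed colouring.\<close>

definition ring_step :: "int \<Rightarrow> int \<Rightarrow> int \<Rightarrow> int \<Rightarrow> int \<Rightarrow> int \<times> int" where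
  "ring_step A B p x y = (if even (x + y + p) then ring_out A B x y
     else (- fst (ring_in A B x y), - snd (ring_in A B x y)))"

text \<open>Only the \<open>k\<close> outermost rings are used. With \<open>2 * k \<le> A\<close>
  and \<open>2 * k \<le> B\<close> they avoid the degenerate middle of the rectangle, a line of
  cells that is no cycle.\<close>

definition in_rings :: "int \<Rightarrow> int \<Rightarrow> int \<Rightarrow> int \<Rightarrow> int \<Rightarrow> bool" where
  "in_rings A B k x y \<longleftrightarrow> 0 \<le> x \<and> x < A \<and> 0 \<le> y \<and> y < B \<and> (x < k \<or> A - 1 - x < k \<or> y < k \<or> B - 1 - y < k)"

text \<open>Away from the degenerate middle the four sides are described by linear inequalities,
  including the default branch \<open>(0, -1)\<close>. What follows about rings is then linear
  arithmetic.\<close>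

lemma ring_sides:
  assumes "in_rings A B k x y" "2 * k \<le> A" "2 * k \<le> B"
  shows "ring_out A B x y = (a, b) \<longleftrightarrow> 
    (a = 1 \<and> b = 0 \<and> y \<le> x \<and> x < A - 1 - y \<and> y \<le> B - 1 - y) \<or>
    (a = 0 \<and> b = 1 \<and> A - 1 - x \<le> y \<and> y < B - A + x \<and> A - 1 - x \<le> x) \<or>
    (a = -1 \<and> b = 0 \<and> B - 1 - y < x \<and> x \<le> A - B + y \<and> B - 1 - y \<le> y) \<or>
    (a = 0 \<and> b = -1 \<and> x < y \<and> y \<le> B - 1 - x \<and> x \<le> A - 1 - x)"
   "ring_in A B x y = (a, b) \<longleftrightarrow> 
    (a = 1 \<and> b = 0 \<and> y < x \<and> x \<le> A - 1 - y \<and> y \<le> B - 1 - y) \<or>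
    (a = 0 \<and> b = 1 \<and> A - 1 - x < y \<and> y \<le> B - A + x \<and> A - 1 - x \<le> x) \<or>
    (a = -1 \<and> b = 0 \<and> B - 1 - y \<le> x \<and> x < A - B + y \<and> B - 1 - y \<le> y) \<or>
    (a = 0 \<and> b = -1 \<and> x \<le> y \<and> y < B - 1 - x \<and> x \<le> A - 1 - x)"
  using assms unfolding ring_out_def ring_in_def in_rings_def if_split_eq1 prod.inject
  by (smt (verit, ccfv_threshold))+

lemma ring_out_step:
  assumes "in_rings A B k x y" "2 * k \<le> A" "2 * k \<le> B" "ring_out A B x y = (a, b)"
  shows "\<bar>a\<bar> + \<bar>b\<bar> = 1 \<and> in_rings A B k (x + a) (y + b) \<and> ring_in A B (x + a) (y + b) = (a, b)"
proof -
  have "\<bar>a\<bar> + \<bar>b\<bar> = 1" "in_rings A B k (x + a) (y + b)"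
    using assms(4) assms(1-3) unfolding ring_sides(1)[OF assms(1-3)] in_rings_def by (elim disjE; simp; linarith)+
  moreover have "ring_in A B (x + a) (y + b) = (a, b)"
    using assms(4) assms(2,3) unfolding ring_sides(1)[OF assms(1-3)] ring_sides(2)[OF calculation(2) assms(2,3)] 
    by (elim disjE) simp_all
  ultimately show ?thesis by simp
qed

lemma ring_in_step:
  assumes "in_rings A B k x y" "2 * k \<le> A" "2 * k \<le> B" "ring_in A B x y = (a, b)"
  shows "\<bar>a\<bar> + \<bar>b\<bar> = 1 \<and> in_rings A B k (x - a) (y - b) \<and> ring_out A B (x - a) (y - b) = (a, b)"
proof -
  have "\<bar>a\<bar> + \<bar>b\<bar> = 1" "in_rings A B k (x - a) (y - b)"
    using assms(4) assms(1-3) unfolding ring_sides(2)[OF assms(1-3)] in_rings_def by (elim disjE; simp; linarith)+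
  moreover have "ring_out A B (x - a) (y - b) = (a, b)"
    using assms(4) assms(2,3) unfolding ring_sides(2)[OF assms(1-3)] ring_sides(1)[OF calculation(2) assms(2,3)] 
    by (elim disjE) simp_all
  ultimately show ?thesis by simp
qed

lemma ring_step:
  assumes "in_rings A B k x y" "2 * k \<le> A" "2 * k \<le> B" "ring_step A B p x y = (a, b)"
  shows "\<bar>a\<bar> + \<bar>b\<bar> = 1" "in_rings A B k (x + a) (y + b)" "ring_step A B p (x + a) (y + b) = (- a, - b)"
proof -
  have flip: "even (x + a + (y + b) + p) \<longleftrightarrow> odd (x + y + p)" if "\<bar>a\<bar> + \<bar>b\<bar> = 1"
  proof -
    have "odd (a + b)" using that by presburger
    then show ?thesis by presburger
  qed
  have "\<bar>a\<bar> + \<bar>b\<bar> = 1 \<and> in_rings A B k (x + a) (y + b) \<and> ring_step A B p (x + a) (y + b) = (- a, - b)"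
  proof (cases "even (x + y + p)")
    case True
    then have "ring_out A B x y = (a, b)" using assms(4) by (simp add: ring_step_def)
    from ring_out_step[OF assms(1-3) this] flip True show ?thesis
      by (simp add: ring_step_def)
  next
    case False
    then have "ring_in A B x y = (- a, - b)" using assms(4) by (auto simp: ring_step_def intro: prod_eqI)
    from ring_in_step[OF assms(1-3) this] flip False show ?thesis
      by (simp add: ring_step_def)
  qed
  then show "\<bar>a\<bar> + \<bar>b\<bar> = 1" "in_rings A B k (x + a) (y + b)" "ring_step A B p (x + a) (y + b) = (- a, - b)"
    by blast+
qed

text \<open>A reflection maps rings to rings but reverses the sense in which they are run through.
  Hence leaving and entering steps are exchanged.\<close>

lemma ring_mirror:
  assumes "in_rings A B k x y" "2 * k \<le> A" "2 * k \<le> B"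
  shows "ring_in A B (A - 1 - x) y = (fst (ring_out A B x y), - snd (ring_out A B x y))"
    "ring_out A B (A - 1 - x) y = (fst (ring_in A B x y), - snd (ring_in A B x y))"
proof -
  have m: "in_rings A B k (A - 1 - x) y" using assms(1) by (auto simp: in_rings_def)
  obtain a b c d where e: "ring_out A B x y = (a, b)" "ring_in A B x y = (c, d)" by fastforce
  show "ring_in A B (A - 1 - x) y = (fst (ring_out A B x y), - snd (ring_out A B x y))"
    unfolding e fst_conv snd_conv ring_sides(2)[OF m assms(2,3)] using e(1)[unfolded ring_sides(1)[OF assms]]
    by (elim disjE) simp_all
  show "ring_out A B (A - 1 - x) y = (fst (ring_in A B x y), - snd (ring_in A B x y))"
    unfolding e fst_conv snd_conv ring_sides(1)[OF m assms(2,3)] using e(2)[unfolded ring_sides(2)[OF assms]]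
    by (elim disjE) simp_all
qed

text \<open>For even \<open>A\<close> the reflection also exchanges the two parities, hence forward
  and backward matching. The two reversals cancel, and the matching is its own mirror image.\<close>

lemma ring_step_mirror:
  assumes "in_rings A B k x y" "2 * k \<le> A" "2 * k \<le> B" "even A"
  shows "ring_step A B p (A - 1 - x) y = (- fst (ring_step A B p x y), snd (ring_step A B p x y))"
proof -
  have "even (A - 1 - x + y + p) \<longleftrightarrow> odd (x + y + p)" using assms(4) by presburger
  then show ?thesis using ring_mirror[OF assms(1-3)] by (simp add: ring_step_def)
qed

section \<open>Two linked tubes, and the basic block\<close>

text \<open>The racetrack: the rings surround a hole of size \<open>2 * t\<close> by
  \<open>l\<close>, just wide enough for the inner walls of both shells. Across x the box reads
  shell, bar, two shells, bar, shell, of widths t, c, 2 t, c, t.\<close>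

definition in_core :: "int \<Rightarrow> int \<Rightarrow> int \<Rightarrow> int \<Rightarrow> int \<Rightarrow> int \<Rightarrow> int \<Rightarrow> bool" where
  "in_core c t h l x y z \<longleftrightarrow> t \<le> z \<and> z < t + h \<and> in_rings (2 * c + 2 * t) (l + 2 * c) c (x - t) y"

text \<open>
  In the right half the shell is run through in the mirrored sense. The ends of the box, left over
  by the racetrack, are filled with rings as well; there the tiling is invariant under the
  reflection in x, so that they do not contribute to the twist.
\<close>

definition tubes :: "int \<Rightarrow> int \<Rightarrow> int \<Rightarrow> int \<Rightarrow> int \<Rightarrow> int \<Rightarrow> int \<Rightarrow> int \<times> int \<times> int" where
  "tubes c t h l x y z =
    (if in_core c t h l x y z
       then case ring_step (2 * c + 2 * t) (l + 2 * c) (z + t) (x - t) y of (a, b) \<Rightarrow> (a, b, 0)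
     else if c \<le> y \<and> y < l + c then
       if x < c + 2 * t
         then case ring_step (c + 2 * t) (h + 2 * t) y x z of (a, b) \<Rightarrow> (a, 0, b)
         else case ring_step (c + 2 * t) (h + 2 * t) (y + 1) (2 * c + 4 * t - 1 - x) z of (a, b) \<Rightarrow> (- a, 0, b)
     else case ring_step (2 * c + 4 * t) (h + 2 * t) y x z of (a, b) \<Rightarrow> (a, 0, b))"

context
  fixes c t h l :: int
  assumes nonneg: "0 \<le> c" "0 \<le> t" "0 \<le> h" "0 \<le> l"
begin

text \<open>This and the next two lemmas say why the pieces fit: in a section of constant
  \<open>y\<close>, what the racetrack leaves free is exactly \<open>t\<close> outer rings, of
  either half around a bar, and of the whole section at the U-turns.\<close>

lemma outside_core_left:
  assumes "c \<le> y" "y < l + c" "x < c + 2 * t" "in_box (2 * c + 4 * t) (l + 2 * c) (h + 2 * t) x y z"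
  shows "\<not> in_core c t h l x y z \<longleftrightarrow> in_rings (c + 2 * t) (h + 2 * t) t x z"
  using nonneg assms unfolding in_core_def in_rings_def in_box_def by linarith

lemma outside_core_right:
  assumes "c \<le> y" "y < l + c" "\<not> x < c + 2 * t" "in_box (2 * c + 4 * t) (l + 2 * c) (h + 2 * t) x y z"
  shows "\<not> in_core c t h l x y z \<longleftrightarrow> in_rings (c + 2 * t) (h + 2 * t) t (2 * c + 4 * t - 1 - x) z"
  using nonneg assms unfolding in_core_def in_rings_def in_box_def by linarith

lemma outside_core_end:
  assumes "\<not> (c \<le> y \<and> y < l + c)" "in_box (2 * c + 4 * t) (l + 2 * c) (h + 2 * t) x y z"
  shows "\<not> in_core c t h l x y z \<longleftrightarrow> in_rings (2 * c + 4 * t) (h + 2 * t) t x z"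
  using nonneg assms unfolding in_core_def in_rings_def in_box_def by linarith

lemma pairing_tubes: "pairing (2 * c + 4 * t) (l + 2 * c) (h + 2 * t) (tubes c t h l)"
  unfolding pairing_def
proof (intro allI impI, elim conjE)
  fix x y z p q r
  let ?box = "in_box (2 * c + 4 * t) (l + 2 * c) (h + 2 * t)"
  let ?goal = "\<bar>p\<bar> + \<bar>q\<bar> + \<bar>r\<bar> = 1 \<and> ?box (x + p) (y + q) (z + r) \<and>
          tubes c t h l (x + p) (y + q) (z + r) = (- p, - q, - r)"
  assume b: "?box x y z" and e: "tubes c t h l x y z = (p, q, r)"
  have bounds: "2 * c \<le> 2 * c + 2 * t" "2 * c \<le> l + 2 * c" "2 * t \<le> c + 2 * t" "2 * t \<le> h + 2 * t" 
    "2 * t \<le> 2 * c + 4 * t"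
    using nonneg by simp_all
  consider (core) "in_core c t h l x y z" 
    | (left) "\<not> in_core c t h l x y z" "c \<le> y" "y < l + c" "x < c + 2 * t"
    | (right) "\<not> in_core c t h l x y z" "c \<le> y" "y < l + c" "\<not> x < c + 2 * t"
    | (ends) "\<not> in_core c t h l x y z" "\<not> (c \<le> y \<and> y < l + c)" by blast
  then show ?goal
  proof cases
    case core
    then have r: "in_rings (2 * c + 2 * t) (l + 2 * c) c (x - t) y" and z: "t \<le> z" "z < t + h" and [simp]: "r = 0"
      and s: "ring_step (2 * c + 2 * t) (l + 2 * c) (z + t) (x - t) y = (p, q)"
      using e by (auto simp: in_core_def tubes_def split: prod.splits)
    have m: "x - t + p = x + p - t" by simp
    note R = ring_step[OF r bounds(1,2) s, unfolded m]
    have "in_core c t h l (x + p) (y + q) z" 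
      and T: "ring_step (2 * c + 2 * t) (l + 2 * c) (z + t) (x + p - t) (y + q) = (- p, - q)" 
      and "?box (x + p) (y + q) z"
      using R z nonneg by (auto simp: in_core_def in_rings_def in_box_def)
    then show ?thesis using R(1) by (simp add: tubes_def)
  next
    case left
    then have s: "ring_step (c + 2 * t) (h + 2 * t) y x z = (p, r)" and [simp]: "q = 0"
      using e by (auto simp: tubes_def split: prod.splits)
    note R = ring_step[OF outside_core_left[OF left(2-4) b, THEN iffD1, OF left(1)] bounds(3,4) s]
    have b': "?box (x + p) y (z + r)" and x': "x + p < c + 2 * t" 
      using b R(2) nonneg left by (auto simp: in_box_def in_rings_def)
    from outside_core_left[OF left(2,3) x' b'] R left(2,3) b' x' show ?thesis
      by (simp add: tubes_def)
  next
    case right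
    then have s: "ring_step (c + 2 * t) (h + 2 * t) (y + 1) (2 * c + 4 * t - 1 - x) z = (- p, r)" and [simp]: "q = 0"
      using e by (auto simp: tubes_def split: prod.splits)
    have m: "2 * c + 4 * t - 1 - x + - p = 2 * c + 4 * t - 1 - (x + p)" by simp
    note R = ring_step[OF outside_core_right[OF right(2-4) b, THEN iffD1, OF right(1)] bounds(3,4) s, unfolded m]
    have b': "?box (x + p) y (z + r)" and x': "\<not> x + p < c + 2 * t" 
      using b R(2) nonneg right by (auto simp: in_box_def in_rings_def)
    from outside_core_right[OF right(2,3) x' b'] R right(2,3) b' x' show ?thesis
      by (simp add: tubes_def)
  next
    case ends
    then have s: "ring_step (2 * c + 4 * t) (h + 2 * t) y x z = (p, r)" and [simp]: "q = 0"
      using e by (auto simp: tubes_def split: prod.splits)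
    note R = ring_step[OF outside_core_end[OF ends(2) b, THEN iffD1, OF ends(1)] bounds(5,4) s]
    have b': "?box (x + p) y (z + r)"
      using b R(2) by (auto simp: in_box_def in_rings_def)
    have n: "\<not> in_core c t h l (x + p) y (z + r)" using outside_core_end[OF ends(2) b'] R(2) by simp
    have "tubes c t h l (x + p) y (z + r) = (- p, 0, - r)"
      unfolding tubes_def if_not_P[OF n] if_not_P[OF ends(2)] using R(3) by simp
    then show ?thesis using R(1) b' by simp
  qed
qed

text \<open>The rings involved have even widths \<open>2 * c + 2 * t\<close> and
  \<open>2 * c + 4 * t\<close> in x, so \<open>ring_step_mirror\<close> applies to racetrack and
  filling alike. In the middle part the symmetry is broken on purpose by the \<open>y + 1\<close> in
  the right shell.\<close>

lemma tubes_end_mirror: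
  assumes "\<not> (c \<le> y \<and> y < l + c)" "in_box (2 * c + 4 * t) (l + 2 * c) (h + 2 * t) x y z"
  shows "fst (tubes c t h l (2 * c + 4 * t - 1 - x) y z) = - fst (tubes c t h l x y z)"
    "fst (snd (tubes c t h l (2 * c + 4 * t - 1 - x) y z)) = fst (snd (tubes c t h l x y z))"
proof -
  have b: "in_box (2 * c + 4 * t) (l + 2 * c) (h + 2 * t) (2 * c + 4 * t - 1 - x) y z"
    using assms(2) by (auto simp: in_box_def)
  have e: "2 * c + 4 * t - 1 - x - t = 2 * c + 2 * t - 1 - (x - t)" by simp
  have core: "in_core c t h l (2 * c + 4 * t - 1 - x) y z = in_core c t h l x y z"
    unfolding in_core_def e by (auto simp: in_rings_def)
  have "fst (tubes c t h l (2 * c + 4 * t - 1 - x) y z) = - fst (tubes c t h l x y z) \<and>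
    fst (snd (tubes c t h l (2 * c + 4 * t - 1 - x) y z)) = fst (snd (tubes c t h l x y z))"
  proof (cases "in_core c t h l x y z")
    case True
    then have "in_rings (2 * c + 2 * t) (l + 2 * c) c (x - t) y" by (simp add: in_core_def)
    from ring_step_mirror[OF this, of "z + t"] nonneg True show ?thesis
      unfolding tubes_def core e by (simp add: case_prod_beta)
  next
    case False
    from ring_step_mirror[OF outside_core_end[OF assms, THEN iffD1, OF this], of y] nonneg show ?thesis
      unfolding tubes_def core if_not_P[OF False] if_not_P[OF assms(1)] by (simp add: case_prod_beta)
  qed
  then show "fst (tubes c t h l (2 * c + 4 * t - 1 - x) y z) = - fst (tubes c t h l x y z)"
    "fst (snd (tubes c t h l (2 * c + 4 * t - 1 - x) y z)) = fst (snd (tubes c t h l x y z))" by auto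
qed

lemma end_columns:
  assumes "\<not> (c \<le> y \<and> y < l + c)" "y \<in> {0..<l + 2 * c}"
  shows "(\<Sum>x\<in>{0..<2 * c + 4 * t}. column (h + 2 * t) (tubes c t h l) x y) = 0"
proof -
  let ?f = "\<lambda>x. column (h + 2 * t) (tubes c t h l) x y"
  have "?f (2 * c + 4 * t - 1 - x) = - ?f x" if "x \<in> {0..<2 * c + 4 * t}" for x
    unfolding column_def sum_negf[symmetric]
    by (rule sum.cong[OF refl], rule sum.cong[OF refl])
       (use that assms(2) in \<open>simp add: tubes_end_mirror[OF assms(1)] in_box_def\<close>)
  then have "(\<Sum>x\<in>{0..<2 * c + 4 * t}. ?f x) = - (\<Sum>x\<in>{0..<2 * c + 4 * t}. ?f x)"
    unfolding sum_negf[symmetric] by (subst reflect_sum[symmetric]) (rule sum.cong; simp)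
  then show ?thesis by simp
qed

text \<open>The column crosses the shell below the bar, the bar, and the shell above. The shell flow
  reverses from below to above, and so does \<open>sgn\<close>. Each of the \<open>2 * t\<close>
  shell cells thus contributes +1 with each of the \<open>h\<close> bar cells. The sign
  \<open>s\<close> enters squared, since at the other bar both flows are reversed.\<close>

lemma bar_column:
  assumes "\<And>z. z \<in> {0..<h + 2 * t} \<Longrightarrow> fst (w x y z) = (if z < t then s * colour (x + y + z) 
       else if z < t + h then 0 else - s * colour (x + y + z))"
    and "\<And>z. z \<in> {0..<h + 2 * t} \<Longrightarrow> fst (snd (w x y z)) = (if t \<le> z \<and> z < t + h then - s * colour (x + y + z) else 0)"
    and "s * s = 1"
  shows "column (h + 2 * t) w x y = 2 * t * h"
proof -
  have "column (h + 2 * t) w x y = (\<Sum>z\<in>{0..<h + 2 * t}. \<Sum>z'\<in>{0..<h + 2 * t}.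
     of_bool (t \<le> z \<and> z < t + h) * of_bool (z' < t \<or> t + h \<le> z'))"
    unfolding column_def
  proof (rule sum.cong[OF refl], rule sum.cong[OF refl])
    fix z z' assume zz: "z \<in> {0..<h + 2 * t}" "z' \<in> {0..<h + 2 * t}"
    have s: "s * (s * k) = k" for k using assms(3) by (simp add: mult.assoc[symmetric])
    show "sgn (z' - z) * colour (z' - z) * fst (w x y z') * fst (snd (w x y z)) =
       of_bool (t \<le> z \<and> z < t + h) * of_bool (z' < t \<or> t + h \<le> z')"
      unfolding assms(1)[OF zz(2)] assms(2)[OF zz(1)]
      using colour_diff[of "x + y + z'" "x + y + z"]
      by (auto simp: sgn_if s assms(3) mult_ac)
  qed
  also have "\<dots> = (\<Sum>z\<in>{0..<h + 2 * t}. of_bool (t \<le> z \<and> z < t + h)) * (\<Sum>z'\<in>{0..<h + 2 * t}. of_bool (z' < t \<or> t + h \<le> z'))"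
    by (rule sum_product[symmetric])
  also have "(\<Sum>z\<in>{0..<h + 2 * t}. of_bool (t \<le> z \<and> z < t + h)) = h"
  proof -
    have "{0..<h + 2 * t} \<inter> {z. t \<le> z \<and> z < t + h} = {t..<t + h}" using nonneg by auto
    then show ?thesis using nonneg by simp
  qed
  also have "(\<Sum>z\<in>{0..<h + 2 * t}. of_bool (z < t \<or> t + h \<le> z)) = 2 * t"
  proof -
    have "{0..<h + 2 * t} \<inter> {z. z < t \<or> t + h \<le> z} = {0..<t} \<union> {t + h..<h + 2 * t}" using nonneg by auto
    moreover have "card ({0..<t} \<union> {t + h..<h + 2 * t}) = nat t + nat t"
      using nonneg by (subst card_Un_disjoint) auto
    ultimately show ?thesis using nonneg by (simp del: of_bool_or_iff)
  qed
  finally show ?thesis by (simp add: mult_ac)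
qed

text \<open>Over the width of the bar the shell has no corners, so \<open>ring_out\<close> and
  \<open>ring_in\<close> agree and the two matchings differ only by a sign.\<close>

lemma shell_sides:
  assumes "u \<in> {t..<t + c}" "z < t \<or> t + h \<le> z" "z \<in> {0..<h + 2 * t}"
  shows "ring_step (c + 2 * t) (h + 2 * t) p u z = ((if z < t then 1 else -1) * colour (u + z + p), 0)"
proof -
  have r: "in_rings (c + 2 * t) (h + 2 * t) t u z" using assms nonneg by (auto simp: in_rings_def)
  have b: "2 * t \<le> c + 2 * t" "2 * t \<le> h + 2 * t" using nonneg by auto
  have "ring_out (c + 2 * t) (h + 2 * t) u z = (if z < t then 1 else -1, 0)" 
    "ring_in (c + 2 * t) (h + 2 * t) u z = (if z < t then 1 else -1, 0)"
    using nonneg assms unfolding ring_sides[OF r b] by auto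
  then show ?thesis by (simp add: ring_step_def colour_def)
qed

lemma core_sides:
  assumes "c \<le> y" "y < l + c"
  shows "u \<in> {0..<c} \<Longrightarrow> ring_step (2 * c + 2 * t) (l + 2 * c) p u y = (0, - colour (u + y + p))"
    and "u \<in> {c + 2 * t..<2 * c + 2 * t} \<Longrightarrow> ring_step (2 * c + 2 * t) (l + 2 * c) p u y = (0, colour (u + y + p))"
proof -
  have b: "2 * c \<le> 2 * c + 2 * t" "2 * c \<le> l + 2 * c" using nonneg by auto
  { assume u: "u \<in> {0..<c}"
    have r: "in_rings (2 * c + 2 * t) (l + 2 * c) c u y" using u assms nonneg by (auto simp: in_rings_def)
    have "ring_out (2 * c + 2 * t) (l + 2 * c) u y = (0, -1)" "ring_in (2 * c + 2 * t) (l + 2 * c) u y = (0, -1)"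
      using u assms nonneg unfolding ring_sides[OF r b] by auto
    then show "ring_step (2 * c + 2 * t) (l + 2 * c) p u y = (0, - colour (u + y + p))"
      by (simp add: ring_step_def colour_def) }
  { assume u: "u \<in> {c + 2 * t..<2 * c + 2 * t}"
    have r: "in_rings (2 * c + 2 * t) (l + 2 * c) c u y" using u assms nonneg by (auto simp: in_rings_def)
    have "ring_out (2 * c + 2 * t) (l + 2 * c) u y = (0, 1)" "ring_in (2 * c + 2 * t) (l + 2 * c) u y = (0, 1)"
      using u assms nonneg unfolding ring_sides[OF r b] by auto
    then show "ring_step (2 * c + 2 * t) (l + 2 * c) p u y = (0, colour (u + y + p))"
      by (simp add: ring_step_def colour_def) }
qed

lemma middle_column:
  assumes y: "c \<le> y" "y < l + c" and x: "x \<in> {0..<2 * c + 4 * t}"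
  shows "column (h + 2 * t) (tubes c t h l) x y = 
    (if x \<in> {t..<t + c} \<union> {c + 3 * t..<2 * c + 3 * t} then 2 * t * h else 0)"
proof -
  have box: "in_box (2 * c + 4 * t) (l + 2 * c) (h + 2 * t) x y z" if "z \<in> {0..<h + 2 * t}" for z
    using assms that nonneg by (simp add: in_box_def)
  consider (left) "x \<in> {t..<t + c}" | (right) "x \<in> {c + 3 * t..<2 * c + 3 * t}" 
    | (neither) "x \<notin> {t..<t + c} \<union> {c + 3 * t..<2 * c + 3 * t}" by blast
  then show ?thesis
  proof cases
    case left
    have x2: "x < c + 2 * t" using left nonneg by simp
    have core: "in_core c t h l x y z \<longleftrightarrow> t \<le> z \<and> z < t + h" for z
      using left y nonneg by (auto simp: in_core_def in_rings_def)
    have 1: "tubes c t h l x y z = (0, - colour (x + y + z), 0)" if "t \<le> z" "z < t + h" for z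
      using core_sides(1)[OF y, of "x - t" "z + t"] left core[of z] that by (simp add: tubes_def add_ac)
    have 2: "tubes c t h l x y z = ((if z < t then 1 else -1) * colour (x + y + z), 0, 0)" 
      if "z < t \<or> t + h \<le> z" "z \<in> {0..<h + 2 * t}" for z
    proof -
      have "\<not> in_core c t h l x y z" using core[of z] that(1) by auto
      then show ?thesis 
        using shell_sides[OF left that, of y] y x2 by (simp add: tubes_def add_ac)
    qed
    have "column (h + 2 * t) (tubes c t h l) x y = 2 * t * h"
      by (rule bar_column[where s = 1]) (use 1 2 in \<open>auto simp: not_less\<close>)
    then show ?thesis using left by simp
  next
    case right
    have x2: "\<not> x < c + 2 * t" using right nonneg by simp
    have u: "2 * c + 4 * t - 1 - x \<in> {t..<t + c}" using right by auto
    have core: "in_core c t h l x y z \<longleftrightarrow> t \<le> z \<and> z < t + h" for z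
      using right y nonneg by (auto simp: in_core_def in_rings_def)
    have 1: "tubes c t h l x y z = (0, colour (x + y + z), 0)" if "t \<le> z" "z < t + h" for z
      using core_sides(2)[OF y, of "x - t" "z + t"] right core[of z] that by (simp add: tubes_def add_ac)
    have 2: "tubes c t h l x y z = ((if z < t then -1 else 1) * colour (x + y + z), 0, 0)" 
      if "z < t \<or> t + h \<le> z" "z \<in> {0..<h + 2 * t}" for z
    proof -
      have nc: "\<not> in_core c t h l x y z" using core[of z] that(1) by auto
      \<comment> \<open>Reflecting x changes its parity, and the \<open>+ 1\<close> restores it; the
        sign of the x component is then the opposite of that in the left shell.\<close>
      have "colour (2 * c + 4 * t - 1 - x + z + (y + 1)) = colour (x + y + z)" by (auto simp: colour_def)
      then show ?thesis 
        using shell_sides[OF u that, of "y + 1"] y x2 nc by (simp add: tubes_def)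
    qed
    have "column (h + 2 * t) (tubes c t h l) x y = 2 * t * h"
      by (rule bar_column[where s = "-1"]) (use 1 2 in \<open>auto simp: not_less\<close>)
    then show ?thesis using right by simp
  next
    case neither
    \<comment> \<open>Beside the bars the whole column lies in the shells, whose dominoes have no y
      component.\<close>
    have "fst (snd (tubes c t h l x y z)) = 0" if "z \<in> {0..<h + 2 * t}" for z
    proof -
      have "\<not> in_core c t h l x y z" 
        using neither y nonneg x by (auto simp: in_core_def in_rings_def)
      then show ?thesis using y by (simp add: tubes_def case_prod_beta)
    qed
    then show ?thesis unfolding if_not_P[OF neither] by (simp add: column_def)
  qed
qed

lemma ztwist_tubes: "ztwist (2 * c + 4 * t) (l + 2 * c) (h + 2 * t) (tubes c t h l) = 4 * l * t * c * h"
proof -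
  have "ztwist (2 * c + 4 * t) (l + 2 * c) (h + 2 * t) (tubes c t h l)
     = (\<Sum>y\<in>{0..<l + 2 * c}. \<Sum>x\<in>{0..<2 * c + 4 * t}. column (h + 2 * t) (tubes c t h l) x y)"
    unfolding ztwist_def by (rule sum.swap)
  also have "\<dots> = (\<Sum>y\<in>{0..<l + 2 * c}. of_bool (c \<le> y \<and> y < l + c) * (2 * c * (2 * t * h)))"
  proof (rule sum.cong[OF refl])
    fix y assume y: "y \<in> {0..<l + 2 * c}"
    show "(\<Sum>x\<in>{0..<2 * c + 4 * t}. column (h + 2 * t) (tubes c t h l) x y)
      = of_bool (c \<le> y \<and> y < l + c) * (2 * c * (2 * t * h))"
    proof (cases "c \<le> y \<and> y < l + c")
      case True
      let ?bars = "{t..<t + c} \<union> {c + 3 * t..<2 * c + 3 * t}"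
      have "(\<Sum>x\<in>{0..<2 * c + 4 * t}. column (h + 2 * t) (tubes c t h l) x y)
         = (\<Sum>x\<in>{0..<2 * c + 4 * t}. if x \<in> ?bars then 2 * t * h else 0)"
        using True by (intro sum.cong refl middle_column) auto
      also have "\<dots> = (\<Sum>x\<in>{0..<2 * c + 4 * t} \<inter> ?bars. 2 * t * h)"
        by (rule sum.inter_restrict[symmetric]) simp
      also have "{0..<2 * c + 4 * t} \<inter> ?bars = ?bars" using nonneg by auto
      also have "(\<Sum>x\<in>?bars. 2 * t * h) = 2 * c * (2 * t * h)"
        using nonneg by (subst sum.union_disjoint) auto
      finally show ?thesis using True by simp
    next
      case False
      then show ?thesis using end_columns[OF False y] by simp
    qed
  qed
  also have "\<dots> = (\<Sum>y\<in>{0..<l + 2 * c}. of_bool (c \<le> y \<and> y < l + c)) * (2 * c * (2 * t * h))"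
    by (rule sum_distrib_right[symmetric])
  also have "(\<Sum>y\<in>{0..<l + 2 * c}. of_bool (c \<le> y \<and> y < l + c)) = l"
  proof -
    have "{0..<l + 2 * c} \<inter> {y. c \<le> y \<and> y < l + c} = {c..<l + c}" using nonneg by auto
    then show ?thesis using nonneg by simp
  qed
  finally show ?thesis by simp
qed

end

lemma attains_tubes: "attains (2 * c + 4 * t) (l + 2 * c) (h + 2 * t) (int (4 * l * t * c * h))"
  unfolding attains_def
  using pairing_tubes[of "int c" "int t" "int h" "int l"] ztwist_tubes[of "int c" "int t" "int h" "int l"]
  by (intro exI[of _ "tubes (int c) (int t) (int h) (int l)"]) simp

text \<open>Each of the two layers is a ring of eight cells around one central cell. The parity
  \<open>z\<close> makes both rings run in the same sense around the vertical domino in the middle;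
  \<open>1 - 2 * z\<close> is the step to its other cell.\<close>

lemma attains_block: "attains 3 3 2 4"
proof -
  define w :: "int \<Rightarrow> int \<Rightarrow> int \<Rightarrow> int \<times> int \<times> int" where
    "w x y z = (if x = 1 \<and> y = 1 then (0, 0, 1 - 2 * z) else case ring_step 3 3 z x y of (a, b) \<Rightarrow> (a, b, 0))" for x y z
  have "pairing 3 3 2 w"
    unfolding pairing_def
  proof (intro allI impI, elim conjE)
    fix x y z a b c
    assume b: "in_box 3 3 2 x y z" and e: "w x y z = (a, b, c)"
    show "\<bar>a\<bar> + \<bar>b\<bar> + \<bar>c\<bar> = 1 \<and> in_box 3 3 2 (x + a) (y + b) (z + c) \<and> w (x + a) (y + b) (z + c) = (- a, - b, - c)"
    proof (cases "x = 1 \<and> y = 1")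
      case True
      moreover have "z = 0 \<or> z = 1" using b by (auto simp: in_box_def)
      ultimately show ?thesis using e by (auto simp: w_def in_box_def)
    next
      case False
      have "in_rings 3 3 1 x y" using False b by (auto simp: in_rings_def in_box_def)
      moreover have "ring_step 3 3 z x y = (a, b)" "c = 0" using False e by (auto simp: w_def split: prod.splits)
      ultimately show ?thesis using ring_step[of 3 3 1 x y z a b] b
        by (auto simp: w_def in_box_def in_rings_def)
    qed
  qed
  moreover have "ztwist 3 3 2 w = 4"
  proof -
    have 3: "{0..<3} = {0, 1, 2 :: int}" and 2: "{0..<2} = {0, 1 :: int}" by auto
    show ?thesis
      unfolding ztwist_def column_def 3 2
      by (simp add: w_def ring_step_def ring_out_def ring_in_def colour_def)
  qed
  ultimately show ?thesis unfolding attains_def by (intro exI[of _ w]) simp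
qed

section \<open>Boxes with large twist\<close>

lemma attains_scale:
  assumes "attains L M N k"
  shows "attains (n * L) M N (int n * k)"
proof (induction n)
  case 0
  then show ?case using attains_zero[of 0 M N] by simp
next
  case (Suc n)
  then show ?case using attains_append[OF assms Suc] by (simp add: algebra_simps)
qed

lemma attains_pad:
  assumes "attains L M N k" "L \<le> L'" "even (M * N)"
  shows "attains L' M N k"
  using attains_append[OF assms(1) attains_zero[of "L' - L" M N]] assms(2,3) by simp

text \<open>Slabs of thickness 2 are cut into 3 by 3 squares and stacked \<open>d\<close> times. The
  remainders modulo 3 are padded with twist zero, which is possible because the side of length 2 is
  present throughout.\<close>

lemma attains_blocks: "attains L M (2 * d) (4 * int ((L div 3) * (M div 3) * d))"
proof -
  have pad: "attains L M N (int (L div 3) * k)" if "attains 3 M N k" "even (M * N)" for L M N k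
    by (rule attains_pad[OF attains_scale[OF that(1)]]) (use that in auto)
  have "attains L 3 2 (int (L div 3) * 4)" by (rule pad[OF attains_block]) simp
  from pad[OF attains_swap[OF this], of M] have "attains M L 2 (int (M div 3) * (int (L div 3) * 4))"
    by simp
  then have "attains 2 M L (int (M div 3) * (int (L div 3) * 4))"
    by (rule attains_cycle[OF attains_cycle])
  from attains_cycle[OF attains_scale[OF this, of d]]
  have "attains M L (2 * d) (int d * (int (M div 3) * (int (L div 3) * 4)))" by (simp add: mult.commute)
  from attains_swap[OF this] show ?thesis by (simp add: mult_ac)
qed

text \<open>The lower bound with constant 1/162 and cleared denominators; the factor 4 is that of
  \<open>attains\<close>. Its symmetry in the sides allows the smallest one to be put first.\<close>

definition large_twist :: "nat \<Rightarrow> nat \<Rightarrow> nat \<Rightarrow> bool" where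
  "large_twist L M N \<longleftrightarrow> (\<exists>k. attains L M N k \<and> 4 * int (L * M * N * min L (min M N)) \<le> 162 * k)"

lemma large_twist_cycle: "large_twist L M N \<Longrightarrow> large_twist M N L"
proof -
  assume "large_twist L M N"
  moreover have "L * M * N = M * N * L" "min L (min M N) = min M (min N L)" by (simp_all add: ac_simps)
  ultimately show "large_twist M N L" unfolding large_twist_def by (metis attains_cycle)
qed

lemma large_twist_swap: "large_twist L M N \<Longrightarrow> large_twist M L N"
proof -
  assume "large_twist L M N"
  moreover have "L * M * N = M * L * N" "min L (min M N) = min M (min L N)" by (simp_all add: ac_simps)
  ultimately show "large_twist M L N" unfolding large_twist_def by (metis attains_swap)
qed

lemma large_twist_last_swap: "large_twist L M N \<Longrightarrow> large_twist L N M"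
  by (meson large_twist_cycle large_twist_swap)

lemma large_twistI:
  assumes "attains L M N (4 * int k)" "L \<le> M" "L \<le> N" "L * M * N * L \<le> 162 * k"
  shows "large_twist L M N"
proof -
  have "int (L * M * N * L) \<le> int (162 * k)" using assms(4) by (simp only: of_nat_le_iff)
  then show ?thesis using assms(1-3) unfolding large_twist_def by (intro exI[of _ "4 * int k"]) (simp add: mult_ac)
qed

text \<open>The bound for a cube of side L = 6 q + 2 r + e, with shells of thickness
  \<open>q\<close> and a racetrack of width \<open>q + r\<close>. For r = e = 0 the product is L^4 /
  81. Writing q = p + 1 makes each of the six remainder cases an inequality of polynomials in p that
  holds coefficient by coefficient.\<close>

lemma tube_parameters:
  fixes q r e :: nat
  assumes "1 \<le> q" "r < 3" "e < 2"
  shows "(2 * (3 * q + r) + e) ^ 4 \<le> 162 * (q * (q + r) * (4 * q + e) * (4 * q + 2 * r + e))"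
proof -
  obtain p where q: "q = Suc p" using assms(1) by (cases q) auto
  from assms have "r = 0 \<or> r = 1 \<or> r = 2" by linarith
  moreover from assms have "e = 0 \<or> e = 1" by linarith
  ultimately show ?thesis
    unfolding q by (elim disjE) (simp_all add: algebra_simps power4_eq_xxxx)
qed

lemma large_twist_large:
  assumes "6 \<le> L" "L \<le> M" "L \<le> N" "even (L * M * N)"
  shows "large_twist L M N"
proof -
  define q r e where "q = L div 2 div 3" and "r = L div 2 mod 3" and "e = L mod 2"
  \<comment> \<open>The tubes have width \<open>2 * c + 4 * q = L - e\<close>; an odd layer is
    padded. The numbers \<open>u\<close> and \<open>s\<close> are the values of \<open>l\<close> and
    \<open>h\<close> for a cube of side \<open>L\<close>.\<close>
  define c where "c = q + r"
  define u where "u = 4 * q + e"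
  define s where "s = 4 * q + 2 * r + e"
  have L: "L = 2 * (3 * q + r) + e" unfolding q_def r_def e_def by simp
  have qre: "1 \<le> q" "r < 3" "e < 2" using assms(1) by (auto simp: q_def r_def e_def)
  obtain v v' where v: "M = L + v" "N = L + v'" using assms(2,3) le_Suc_ex by metis
  define l h where "l = u + v" and "h = s + v'"
  have dims: "2 * c + 4 * q = L - e" "l + 2 * c = M" "h + 2 * q = N"
    by (simp_all add: v L c_def l_def h_def u_def s_def)
  have tubes: "attains (L - e) M N (4 * int (l * q * c * h))"
    using attains_tubes[of c q l h] unfolding dims by (simp add: mult_ac)
  have "attains L M N (4 * int (l * q * c * h))"
  proof (cases "e = 0")
    case True
    then show ?thesis using tubes by simp
  next
    case False
    then have "odd L" unfolding e_def by presburger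
    then show ?thesis using assms(4) by (intro attains_pad[OF tubes]) auto
  qed
  moreover have "L * M * N * L \<le> 162 * (l * q * c * h)"
  proof -
    \<comment> \<open>Lengthening a side by \<open>v\<close> lengthens \<open>l\<close> by all of
      \<open>v\<close>, and u (L + v) <= (u + v) L because u <= L. So the fraction of the side that
      is used only grows, and the cube is the worst case.\<close>
    have "u * M \<le> l * L" "s * N \<le> h * L"
      by (simp_all add: v l_def h_def distrib_left distrib_right) (simp_all add: L u_def s_def)
    then have 1: "(u * M) * (s * N) \<le> (l * L) * (h * L)" by (rule mult_le_mono)
    have "L ^ 4 \<le> 162 * (q * c * u * s)"
      using tube_parameters[OF qre] unfolding L[symmetric] c_def u_def s_def .
    then have "L ^ 4 * (M * N) \<le> 162 * (q * c * u * s) * (M * N)" by (rule mult_le_mono1)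
    also have "\<dots> = 162 * (q * c) * ((u * M) * (s * N))" by simp
    also have "\<dots> \<le> 162 * (q * c) * ((l * L) * (h * L))" using 1 by (rule mult_le_mono2)
    finally have "(L * L) * (L * M * N * L) \<le> (L * L) * (162 * (l * q * c * h))"
      by (simp add: power4_eq_xxxx mult_ac)
    then show ?thesis using assms(1) by simp
  qed
  ultimately show ?thesis using assms(2,3) by (intro large_twistI)
qed

text \<open>The worst loss is at n = 5, where only one block of length 3 fits; this is why the side
  5 gets separate treatment below.\<close>

lemma div3_bounds:
  fixes n :: nat
  assumes "3 \<le> n"
  shows "n \<le> 5 * (n div 3)" "1 \<le> n div 3" "4 \<le> n \<Longrightarrow> n \<noteq> 5 \<Longrightarrow> n \<le> 4 * (n div 3)"
  using assms by presburger+

section \<open>Boxes with a side below 6\<close>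

lemma large_twist_2:
  assumes "3 \<le> M" "3 \<le> N"
  shows "large_twist 2 M N"
proof -
  have "attains M N 2 (4 * int ((M div 3) * (N div 3)))" using attains_blocks[of M N 1] by simp
  then have "attains 2 M N (4 * int ((M div 3) * (N div 3)))" by (rule attains_cycle[OF attains_cycle])
  moreover have "M * N \<le> (5 * (M div 3)) * (5 * (N div 3))" using assms by (intro mult_le_mono div3_bounds)
  then have "2 * M * N * 2 \<le> 162 * ((M div 3) * (N div 3))" by simp
  ultimately show ?thesis using assms by (intro large_twistI) auto
qed

lemma large_twist_3:
  assumes "3 \<le> M" "3 \<le> N" "even N"
  shows "large_twist 3 M N"
proof -
  obtain d where N: "N = 2 * d" using assms(3) by blast
  have "attains 3 M N (4 * int ((M div 3) * d))" using attains_blocks[of 3 M d] by (simp add: N)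
  moreover have "M * d \<le> (5 * (M div 3)) * d" using assms by (intro mult_le_mono1 div3_bounds)
  then have "3 * M * N * 3 \<le> 162 * ((M div 3) * d)" by (auto simp: N)
  ultimately show ?thesis using assms by (intro large_twistI)
qed

lemma large_twist_4:
  assumes "4 \<le> M" "4 \<le> N"
  shows "large_twist 4 M N"
proof (cases "M = 5 \<and> N = 5")
  case True
  \<comment> \<open>Uniform layers would give twist 2, but 400 / 162 exceeds 2. Cutting one side as
    3 + 2 and orienting the blocks differently in the two parts gives 2 + 1.\<close>
  have "attains 3 5 4 (4 * int 2)" using attains_blocks[of 3 5 2] by simp
  moreover have "attains 5 4 2 4" using attains_blocks[of 5 4 1] by simp
  then have "attains 2 5 4 4" by (rule attains_cycle[OF attains_cycle])
  ultimately have "attains 5 5 4 12" using attains_append[of 3 5 4 8 2 4] by simp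
  then have "attains 4 5 5 (4 * int 3)" using attains_cycle[OF attains_cycle] by simp
  then have "large_twist 4 5 5" by (rule large_twistI) simp_all
  then show ?thesis using True by simp
next
  case False
  have "attains M N 4 (4 * int ((M div 3) * (N div 3) * 2))" using attains_blocks[of M N 2] by simp
  then have "attains 4 M N (4 * int ((M div 3) * (N div 3) * 2))" by (rule attains_cycle[OF attains_cycle])
  \<comment> \<open>The factor 20 is just good enough, since 16 * 20 = 320 is at most 2 * 162 = 324;
    two sides of length 5 would give 25.\<close>
  moreover have "M * N \<le> 20 * ((M div 3) * (N div 3))"
  proof (cases "M = 5")
    case True
    then have "M * N \<le> (5 * (M div 3)) * (4 * (N div 3))"
      using False assms by (intro mult_le_mono div3_bounds) auto
    then show ?thesis by simp
  next
    case False
    then have "M * N \<le> (4 * (M div 3)) * (5 * (N div 3))"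
      using assms by (intro mult_le_mono div3_bounds) auto
    then show ?thesis by simp
  qed
  then have "4 * M * N * 4 \<le> 162 * ((M div 3) * (N div 3) * 2)" by simp
  ultimately show ?thesis using assms by (intro large_twistI)
qed

text \<open>The side 5 is split as 3 + 2. In the slab of thickness 3 the blocks have their short
  side along the even \<open>N\<close>, giving \<open>d\<close> per stack; in the slab of thickness
  2 they have it across the slab, giving \<open>e\<close>.\<close>

lemma large_twist_5:
  assumes "5 \<le> M" "5 \<le> N" "even N"
  shows "large_twist 5 M N"
proof -
  obtain d where N: "N = 2 * d" using assms(3) by blast
  define e where "e = N div 3"
  have "5 \<le> 2 * d" using assms by (simp add: N)
  \<comment> \<open>Compares the two kinds of stacks; the ratio \<open>d / e\<close> is largest at N
    = 8, where d = 4 and e = 2.\<close>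
  then have de: "4 * d \<le> 9 * e" unfolding e_def N by presburger
  have three: "attains 3 m N (4 * int ((m div 3) * d))" for m
    using attains_blocks[of 3 m d] by (simp add: N)
  have two: "attains 2 m N (4 * int ((m div 3) * e))" for m
  proof -
    have "attains m N 2 (4 * int ((m div 3) * e))" using attains_blocks[of m N 1] by (simp add: e_def)
    then show ?thesis by (rule attains_cycle[OF attains_cycle])
  qed
  show ?thesis
  proof (cases "M = 5")
    case True
    \<comment> \<open>The 5 by 5 section is cut into 3 by 3, 2 by 3 and 2 by 5, contributing
      \<open>d\<close>, \<open>e\<close> and \<open>e\<close>.\<close>
    have "attains 5 3 N (4 * int d + 4 * int e)" using attains_append[OF three[of 3] two[of 3]] by simp
    then have "attains 3 5 N (4 * int d + 4 * int e)" by (rule attains_swap)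
    from attains_append[OF this two[of 5]] have "attains 5 5 N (4 * int (d + 2 * e))" by (simp add: algebra_simps)
    then have "large_twist 5 5 N" by (rule large_twistI) (use assms de N in auto)
    then show ?thesis using True by simp
  next
    case False
    define b where "b = M div 3"
    have M: "M \<le> 4 * b" unfolding b_def using assms False by (intro div3_bounds) auto
    have att: "attains 5 M N (4 * int (b * d + b * e))"
      using attains_append[OF three[of M] two[of M]] by (simp add: b_def algebra_simps)
    have Md: "M * d \<le> 4 * (b * d)" using mult_le_mono1[OF M, of d] by (simp only: mult.assoc)
    have bd: "4 * (b * d) \<le> 9 * (b * e)" using mult_le_mono2[OF de, of b] by (simp only: mult.left_commute[of b])
    have "50 * m \<le> 162 * (x + y)" if "m \<le> 4 * x" "4 * x \<le> 9 * y" for m x y :: nat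
    proof -
      have "50 * m \<le> 50 * (4 * x)" "10 * (4 * x) \<le> 10 * (9 * y)" using that by simp_all
      then have "50 * m + 72 * y + 2 * x \<le> 162 * (x + y)" by simp
      then show ?thesis by simp
    qed
    from this[OF Md bd] have "5 * M * N * 5 \<le> 162 * (b * d + b * e)" by (simp add: N mult.assoc)
    then show ?thesis using att assms by (intro large_twistI)
  qed
qed

lemma large_twist:
  assumes "2 \<le> L" "2 \<le> M" "2 \<le> N" "2 < L \<and> 2 < M \<or> 2 < L \<and> 2 < N \<or> 2 < M \<and> 2 < N"
    and "even L \<or> even M \<or> even N"
  shows "large_twist L M N"
proof -
  have *: "large_twist L M N"
    if "2 \<le> L" "L \<le> M" "L \<le> N" "2 < L \<and> 2 < M \<or> 2 < L \<and> 2 < N \<or> 2 < M \<and> 2 < N" 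
      "even (L * M * N)" for L M N
  proof -
    have "L = 2 \<or> L = 3 \<or> L = 4 \<or> L = 5 \<or> 6 \<le> L" using that(1) by arith
    then show ?thesis
      using that large_twist_2[of M N] large_twist_4[of M N] large_twist_large[of L M N]
        large_twist_3[of M N] large_twist_3[of N M, THEN large_twist_last_swap]
        large_twist_5[of M N] large_twist_5[of N M, THEN large_twist_last_swap]
      by (elim disjE) auto
  qed
  consider "L \<le> M" "L \<le> N" | "M \<le> L" "M \<le> N" | "N \<le> L" "N \<le> M" by linarith
  then show ?thesis
  proof cases
    case 1
    then show ?thesis using assms by (intro *) auto
  next
    case 2
    then have "large_twist M L N" using assms by (intro *) auto
    then show ?thesis by (rule large_twist_swap)
  next
    case 3
    then have "large_twist N L M" using assms by (intro *) auto
    then show ?thesis by (rule large_twist_cycle)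
  qed
qed

section \<open>Cubes, dominoes and tilings\<close>

lemma ex_3: "(\<exists>i::3. P i) \<longleftrightarrow> P 1 \<or> P 2 \<or> P 3"
  using forall_3[of "\<lambda>i. \<not> P i"] by blast

definition adjacent :: "int ^ 3 \<Rightarrow> int ^ 3 \<Rightarrow> bool" where
  "adjacent p q \<longleftrightarrow> \<bar>q $ 1 - p $ 1\<bar> + \<bar>q $ 2 - p $ 2\<bar> + \<bar>q $ 3 - p $ 3\<bar> = 1"

lemma adjacent_sym: "adjacent p q \<Longrightarrow> adjacent q p"
  by (simp add: adjacent_def abs_minus_commute)

lemma adjacent_iff: "adjacent p q \<longleftrightarrow> (\<exists>i. \<bar>q $ i - p $ i\<bar> = 1 \<and> (\<forall>j. j \<noteq> i \<longrightarrow> q $ j = p $ j))"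
proof
  assume "adjacent p q"
  then have "\<bar>q $ 1 - p $ 1\<bar> = 1 \<and> q $ 2 = p $ 2 \<and> q $ 3 = p $ 3 \<or> 
     \<bar>q $ 2 - p $ 2\<bar> = 1 \<and> q $ 1 = p $ 1 \<and> q $ 3 = p $ 3 \<or>
     \<bar>q $ 3 - p $ 3\<bar> = 1 \<and> q $ 1 = p $ 1 \<and> q $ 2 = p $ 2"
    unfolding adjacent_def by linarith
  then show "\<exists>i. \<bar>q $ i - p $ i\<bar> = 1 \<and> (\<forall>j. j \<noteq> i \<longrightarrow> q $ j = p $ j)"
    unfolding ex_3 forall_3 by auto
next
  assume "\<exists>i. \<bar>q $ i - p $ i\<bar> = 1 \<and> (\<forall>j. j \<noteq> i \<longrightarrow> q $ j = p $ j)"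
  then show "adjacent p q"
    unfolding ex_3 forall_3 adjacent_def by auto
qed

lemma adjacent_colour: "adjacent p q \<Longrightarrow> white q \<longleftrightarrow> black p"
  unfolding adjacent_def white_def by presburger

lemma mem_basic_cube: "x \<in> basic_cube p \<longleftrightarrow> (\<forall>i. real_of_int (p $ i) \<le> x $ i \<and> x $ i \<le> real_of_int (p $ i) + 1)"
  by (simp add: basic_cube_def mem_box_cart)

lemma mem_interior_basic_cube:
  "x \<in> interior (basic_cube p) \<longleftrightarrow> (\<forall>i. real_of_int (p $ i) < x $ i \<and> x $ i < real_of_int (p $ i) + 1)"
  by (simp add: basic_cube_def interior_cbox mem_box_cart)

lemma center_interior: "cube_center p \<in> interior (basic_cube p)"
  by (simp add: mem_interior_basic_cube cube_center_def)

lemma interior_meets_cube: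
  assumes "x \<in> interior (basic_cube p)" "x \<in> basic_cube q"
  shows "p = q"
proof -
  have "p $ i = q $ i" for i
    using assms(1)[unfolded mem_interior_basic_cube, rule_format, of i] assms(2)[unfolded mem_basic_cube, rule_format, of i]
    by linarith
  then show ?thesis by (simp add: vec_eq_iff)
qed

lemma center_mem_iff: "cube_center p \<in> basic_cube q \<longleftrightarrow> p = q"
  using interior_meets_cube[OF center_interior] interior_subset center_interior by blast

lemma cube_subset_Un: "basic_cube p \<subseteq> basic_cube a \<union> basic_cube b \<longleftrightarrow> p = a \<or> p = b"
  using center_mem_iff by blast

text \<open>A cube is the closure of its interior. Moving a common point into the interior makes the
  cube containing it unique, which avoids all boundary cases.\<close>

lemma open_meets_interior_cube:
  assumes "open U" "x \<in> U" "x \<in> basic_cube p"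
  obtains y where "y \<in> U" "y \<in> interior (basic_cube p)"
proof -
  have "closure (interior (basic_cube p)) = closure (basic_cube p)"
    using center_interior[of p] by (intro convex_closure_interior) (auto simp: basic_cube_def)
  also have "\<dots> = basic_cube p" by (simp add: basic_cube_def)
  finally have "U \<inter> interior (basic_cube p) \<noteq> {}"
    using assms open_Int_closure_eq_empty[OF assms(1), of "interior (basic_cube p)"] by auto
  then show ?thesis using that by blast
qed

lemma aff_dim_basic_cube: "aff_dim (basic_cube p) = 3"
  using aff_dim_nonempty_interior[of "basic_cube p"] center_interior[of p] by auto

lemma convex_basic_cube: "convex (basic_cube p)"
  by (simp add: basic_cube_def)

text \<open>The sign \<open>s\<close> distinguishes upper and lower walls. A proper face has
  dimension below 3, and this one together with the centre spans the space, so its dimension is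
  2.\<close>

lemma basic_cube_wall:
  assumes "\<And>x. x \<in> basic_cube p \<Longrightarrow> s * x $ i \<le> s * r" "s = 1 \<or> s = -1"
    "r = real_of_int (p $ i) \<or> r = real_of_int (p $ i) + 1"
  shows "(basic_cube p \<inter> {x. x $ i = r}) facet_of basic_cube p"
proof -
  let ?F = "basic_cube p \<inter> {x. x $ i = r}"
  define f :: "real ^ 3 \<Rightarrow> real ^ 3" where "f x = (\<chi> j. if j = i then r else x $ j)" for x
  have f: "f x \<in> ?F" if "x \<in> basic_cube p" for x
    using that assms(3) by (auto simp: mem_basic_cube f_def)
  define z where "z = cube_center p"
  have z: "z \<in> basic_cube p" by (simp add: z_def center_mem_iff)
  have zi: "z $ i \<noteq> r" using assms(3) by (auto simp: z_def cube_center_def)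
  have eq: "?F = basic_cube p \<inter> {x. (s *\<^sub>R axis i 1) \<bullet> x = s * r}"
    using assms(2) by (auto simp: inner_axis' )
  have face: "?F face_of basic_cube p"
    unfolding eq by (rule face_of_Int_supporting_hyperplane_le) (use assms(1) in \<open>auto simp: convex_basic_cube inner_axis'\<close>)
  have "?F \<noteq> basic_cube p" using z zi by auto
  then have lt: "aff_dim ?F < 3"
    using face_of_aff_dim_lt[OF convex_basic_cube face] by (simp add: aff_dim_basic_cube)
  have "basic_cube p \<subseteq> affine hull (insert z ?F)"
  proof
    fix x assume x: "x \<in> basic_cube p"
    \<comment> \<open>The map \<open>f\<close> projects onto the wall, so \<open>f z - z\<close> is
      parallel to axis \<open>i\<close>; \<open>t\<close> is the multiple of it that carries
      \<open>f x\<close> back to \<open>x\<close>.\<close>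
    define t where "t = (x $ i - r) / (r - z $ i)"
    have *: "f x \<in> affine hull (insert z ?F)" "f z \<in> affine hull (insert z ?F)" "z \<in> affine hull (insert z ?F)"
      using f[OF x] f[OF z] hull_subset[of "insert z ?F" affine] by auto
    have "1 *\<^sub>R f x + t *\<^sub>R f z + (- t) *\<^sub>R z \<in> affine hull (insert z ?F)"
      by (rule mem_affine_3[OF affine_affine_hull *]) simp
    also have "1 *\<^sub>R f x + t *\<^sub>R f z + (- t) *\<^sub>R z = x"
    proof -
      have "t * (r - z $ i) = x $ i - r" using zi by (simp add: t_def)
      then show ?thesis by (auto simp: vec_eq_iff f_def algebra_simps)
    qed
    finally show "x \<in> affine hull (insert z ?F)" .
  qed
  then have "aff_dim (basic_cube p) \<le> aff_dim (insert z ?F)"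
    by (metis aff_dim_affine_hull aff_dim_subset)
  then have "aff_dim ?F = 2"
    using lt unfolding aff_dim_insert aff_dim_basic_cube by (auto split: if_splits)
  moreover have "?F \<noteq> {}" using f[OF z] by blast
  ultimately show ?thesis using face by (simp add: facet_of_def aff_dim_basic_cube)
qed

text \<open>On a common facet every coordinate in which \<open>p\<close> and \<open>q\<close> differ
  is constant, equal to the larger of the two corners. Two such coordinates would leave dimension at
  most 1, so there is exactly one; conversely the common wall is a facet of both cubes.\<close>

lemma share_face_iff: "share_face p q \<longleftrightarrow> adjacent p q"
proof
  assume "share_face p q"
  then obtain F where ne: "p \<noteq> q" and F: "F facet_of basic_cube p" "F facet_of basic_cube q"
    by (auto simp: share_face_def)
  have sub: "F \<subseteq> basic_cube p" "F \<subseteq> basic_cube q" using F facet_of_imp_subset by blast+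
  have dim: "aff_dim F = 2" and "F \<noteq> {}" using F(1) by (auto simp: facet_of_def aff_dim_basic_cube)
  then obtain x where x: "x \<in> F" by blast
  obtain i where i: "p $ i \<noteq> q $ i" using ne by (auto simp: vec_eq_iff)
  have mx: "y $ k = real_of_int (max (p $ k) (q $ k))" if "y \<in> F" "p $ k \<noteq> q $ k" for y k
  proof -
    have "y \<in> basic_cube p" "y \<in> basic_cube q" using that sub by auto
    then show ?thesis using that(2) unfolding mem_basic_cube max_def
      by (smt (verit) of_int_less_iff of_int_1 of_int_add zle_add1_eq_le linorder_neqE_linordered_idom of_int_le_iff)
  qed
  have "\<bar>q $ i - p $ i\<bar> = 1"
  proof -
    have "x \<in> basic_cube p" "x \<in> basic_cube q" using x sub by auto
    then have "real_of_int (p $ i) \<le> real_of_int (q $ i) + 1" "real_of_int (q $ i) \<le> real_of_int (p $ i) + 1"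
      unfolding mem_basic_cube by (meson order_trans)+
    then show ?thesis using i by linarith
  qed
  moreover have "q $ j = p $ j" if "j \<noteq> i" for j
  proof (rule ccontr)
    assume j: "q $ j \<noteq> p $ j"
    let ?H = "\<lambda>k. {y :: real ^ 3. axis k 1 \<bullet> y = real_of_int (max (p $ k) (q $ k))}"
    have "F \<subseteq> ?H i \<inter> ?H j" using mx i j by (auto simp: inner_axis')
    then have "aff_dim F \<le> aff_dim (?H i \<inter> ?H j)" by (rule aff_dim_subset)
    also have "\<dots> < aff_dim (?H i)"
    proof (rule aff_dim_psubset)
      have a: "affine (?H i \<inter> ?H j)" "affine (?H i)" by (auto intro!: affine_Int affine_hyperplane)
      let ?y = "(\<chi> k. if k = i then real_of_int (max (p $ i) (q $ i)) else real_of_int (max (p $ j) (q $ j)) + 1) :: real ^ 3"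
      have "?y \<in> ?H i" "?y \<notin> ?H j" using that by (auto simp: inner_axis')
      then show "affine hull (?H i \<inter> ?H j) \<subset> affine hull (?H i)"
        unfolding affine_hull_eq[THEN iffD2, OF a(1)] affine_hull_eq[THEN iffD2, OF a(2)] by blast
    qed
    also have "\<dots> = 2" by (subst aff_dim_hyperplane) auto
    finally show False using dim by simp
  qed
  ultimately show "adjacent p q" unfolding adjacent_iff by blast
next
  have *: "share_face p q" if "q $ i = p $ i + 1" "\<And>j. j \<noteq> i \<Longrightarrow> q $ j = p $ j" for p q :: "int ^ 3" and i
  proof -
    let ?r = "real_of_int (q $ i)"
    have "x $ i \<le> ?r" if "x \<in> basic_cube p" for x
      using that \<open>q $ i = p $ i + 1\<close> by (simp add: mem_basic_cube)
    then have "(basic_cube p \<inter> {x. x $ i = ?r}) facet_of basic_cube p"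
      using that by (intro basic_cube_wall[where s = 1]) auto
    moreover have "?r \<le> x $ i" if "x \<in> basic_cube q" for x
      using that by (simp add: mem_basic_cube)
    then have "(basic_cube q \<inter> {x. x $ i = ?r}) facet_of basic_cube q"
      by (intro basic_cube_wall[where s = "-1"]) auto
    moreover have "basic_cube p \<inter> {x. x $ i = ?r} = basic_cube q \<inter> {x. x $ i = ?r}"
    proof -
      have "(real_of_int (p $ j) \<le> x $ j \<and> x $ j \<le> real_of_int (p $ j) + 1) =
         (real_of_int (q $ j) \<le> x $ j \<and> x $ j \<le> real_of_int (q $ j) + 1)" if "x $ i = ?r" for x :: "real ^ 3" and j
        using that \<open>q $ i = p $ i + 1\<close> \<open>\<And>j. j \<noteq> i \<Longrightarrow> q $ j = p $ j\<close>[of j] by (cases "j = i") auto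
      then show ?thesis by (auto simp: mem_basic_cube)
    qed
    moreover have "p \<noteq> q" using that(1) by auto
    ultimately show ?thesis unfolding share_face_def by metis
  qed
  assume "adjacent p q"
  then obtain i where i: "\<bar>q $ i - p $ i\<bar> = 1" "\<And>j. j \<noteq> i \<Longrightarrow> q $ j = p $ j"
    unfolding adjacent_iff by blast
  then have "q $ i = p $ i + 1 \<or> p $ i = q $ i + 1" by linarith
  then show "share_face p q"
  proof
    assume "q $ i = p $ i + 1"
    then show ?thesis using *[of q i p] i(2) by simp
  next
    assume "p $ i = q $ i + 1"
    then have "share_face q p" using *[of p i q] i(2) by simp
    then show ?thesis by (auto simp: share_face_def)
  qed
qed

section \<open>Tilings as perfect matchings of the cells\<close>

definition piece :: "(int ^ 3 \<Rightarrow> int ^ 3) \<Rightarrow> int ^ 3 \<Rightarrow> (real ^ 3) set" where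
  "piece \<pi> c = basic_cube c \<union> basic_cube (\<pi> c)"

definition cell_matching :: "(int ^ 3) set \<Rightarrow> (int ^ 3 \<Rightarrow> int ^ 3) \<Rightarrow> bool" where
  "cell_matching B \<pi> \<longleftrightarrow> (\<forall>c\<in>B. \<pi> c \<in> B \<and> \<pi> (\<pi> c) = c \<and> adjacent c (\<pi> c))"

lemma domino_iff: "domino d \<longleftrightarrow> (\<exists>p q. adjacent p q \<and> d = basic_cube p \<union> basic_cube q)"
  by (simp add: domino_def share_face_iff)

definition cells :: "nat \<Rightarrow> nat \<Rightarrow> nat \<Rightarrow> (int ^ 3) set" where
  "cells L M N = {c. 0 \<le> c $ 1 \<and> c $ 1 < int L \<and> 0 \<le> c $ 2 \<and> c $ 2 < int M \<and> 0 \<le> c $ 3 \<and> c $ 3 < int N}"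

lemma mem_lattice_box: "x \<in> lattice_box L M N \<longleftrightarrow> 0 \<le> x $ 1 \<and> x $ 1 \<le> real L \<and> 0 \<le> x $ 2 \<and> x $ 2 \<le> real M \<and> 0 \<le> x $ 3 \<and> x $ 3 \<le> real N"
  by (simp add: lattice_box_def mem_box_cart forall_3 vector_3)

lemma Union_cells:
  assumes "0 < L" "0 < M" "0 < N"
  shows "(\<Union>c\<in>cells L M N. basic_cube c) = lattice_box L M N"
proof (intro equalityI subsetI)
  fix x assume "x \<in> (\<Union>c\<in>cells L M N. basic_cube c)"
  then obtain c where c: "c \<in> cells L M N" "x \<in> basic_cube c" by blast
  from c(1) have "real_of_int (c $ 1) + 1 \<le> real L" "real_of_int (c $ 2) + 1 \<le> real M" "real_of_int (c $ 3) + 1 \<le> real N"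
    "0 \<le> real_of_int (c $ 1)" "0 \<le> real_of_int (c $ 2)" "0 \<le> real_of_int (c $ 3)"
    unfolding cells_def by auto
  with c(2) show "x \<in> lattice_box L M N"
    unfolding mem_lattice_box mem_basic_cube forall_3 by linarith
next
  fix x assume x: "x \<in> lattice_box L M N"
  define g where "g K r = min \<lfloor>r\<rfloor> (int K - 1)" for K :: nat and r :: real
  have g: "0 \<le> g K r \<and> g K r < int K \<and> real_of_int (g K r) \<le> r \<and> r \<le> real_of_int (g K r) + 1"
    if "0 \<le> r" "r \<le> real K" "0 < K" for K r
    using that unfolding g_def min_def by (auto; linarith)
  define c :: "int ^ 3" where "c = vector [g L (x $ 1), g M (x $ 2), g N (x $ 3)]"
  have "c \<in> cells L M N \<and> x \<in> basic_cube c"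
    using x g[of "x $ 1" L] g[of "x $ 2" M] g[of "x $ 3" N] assms
    unfolding mem_lattice_box mem_basic_cube forall_3 cells_def c_def by (simp add: vector_3)
  then show "x \<in> (\<Union>c\<in>cells L M N. basic_cube c)" by blast
qed

lemma cell_in_box_iff:
  assumes "0 < L" "0 < M" "0 < N"
  shows "basic_cube c \<subseteq> lattice_box L M N \<longleftrightarrow> c \<in> cells L M N"
proof
  assume "basic_cube c \<subseteq> lattice_box L M N"
  then have "cube_center c \<in> (\<Union>c\<in>cells L M N. basic_cube c)"
    using center_mem_iff[of c c] unfolding Union_cells[OF assms] by blast
  then show "c \<in> cells L M N" by (auto simp: center_mem_iff)
next
  assume "c \<in> cells L M N"
  then show "basic_cube c \<subseteq> lattice_box L M N" using Union_cells[OF assms] by blast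
qed

lemma interior_piece_disjoint:
  assumes "{a, \<pi> a} \<inter> {b, \<pi> b} = {}"
  shows "interior (piece \<pi> a) \<inter> interior (piece \<pi> b) = {}"
proof (rule ccontr)
  let ?U = "interior (piece \<pi> a) \<inter> interior (piece \<pi> b)"
  assume "?U \<noteq> {}"
  then obtain x where x: "x \<in> ?U" by blast
  then have "x \<in> piece \<pi> a" using interior_subset by blast
  then obtain c where c: "c \<in> {a, \<pi> a}" "x \<in> basic_cube c" by (auto simp: piece_def)
  from open_meets_interior_cube[OF _ x c(2)] obtain y where y: "y \<in> ?U" "y \<in> interior (basic_cube c)" by blast
  then have "y \<in> piece \<pi> b" using interior_subset by blast
  then have "c \<in> {b, \<pi> b}" using interior_meets_cube[OF y(2)] by (auto simp: piece_def)
  then show False using assms c(1) by blast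
qed

lemma tiling_of_matching:
  assumes "cell_matching (cells L M N) \<pi>" "0 < L" "0 < M" "0 < N"
  shows "tiling (lattice_box L M N) (piece \<pi> ` cells L M N)"
  unfolding tiling_def
proof (intro conjI ballI)
  note m = assms(1)[unfolded cell_matching_def, rule_format]
  show "domino d" if "d \<in> piece \<pi> ` cells L M N" for d
    using that m unfolding domino_iff piece_def by blast
  show "\<Union> (piece \<pi> ` cells L M N) = lattice_box L M N"
    unfolding Union_cells[OF assms(2-4), symmetric] using m by (auto simp: piece_def)
  show "pairwise (\<lambda>d e. interior d \<inter> interior e = {}) (piece \<pi> ` cells L M N)"
  proof (rule pairwiseI)
    fix d e assume "d \<in> piece \<pi> ` cells L M N" "e \<in> piece \<pi> ` cells L M N" "d \<noteq> e"
    then obtain a b where ab: "a \<in> cells L M N" "b \<in> cells L M N" "d = piece \<pi> a" "e = piece \<pi> b" "piece \<pi> a \<noteq> piece \<pi> b"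
      by blast
    have inv: "\<pi> (\<pi> a) = a" "\<pi> (\<pi> b) = b" using m ab(1,2) by auto
    have "piece \<pi> (\<pi> b) = piece \<pi> b" using inv by (simp add: piece_def Un_commute)
    then have "a \<noteq> b" "a \<noteq> \<pi> b" using ab(5) by auto
    then have "{a, \<pi> a} \<inter> {b, \<pi> b} = {}" using inv by auto
    then show "interior d \<inter> interior e = {}" using interior_piece_disjoint ab by blast
  qed
qed

lemma matching_of_tiling:
  assumes t: "tiling (lattice_box L M N) t" and pos: "0 < L" "0 < M" "0 < N"
  obtains \<pi> where "cell_matching (cells L M N) \<pi>" "t = piece \<pi> ` cells L M N"
proof -
  let ?B = "cells L M N"
  have dom: "\<exists>p q. adjacent p q \<and> d = basic_cube p \<union> basic_cube q" if "d \<in> t" for d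
    using t that unfolding tiling_def domino_iff by blast
  have un: "\<Union> t = lattice_box L M N" using t by (simp add: tiling_def)
  have uniq: "d = e" if "d \<in> t" "e \<in> t" "basic_cube c \<subseteq> d" "basic_cube c \<subseteq> e" for c d e
  proof (rule ccontr)
    assume "d \<noteq> e"
    then have "interior d \<inter> interior e = {}" using t that unfolding tiling_def by (auto dest: pairwiseD)
    moreover have "cube_center c \<in> interior d \<inter> interior e"
      using that center_interior[of c] interior_mono by blast
    ultimately show False by blast
  qed
  have ex: "\<exists>c'. adjacent c c' \<and> basic_cube c \<union> basic_cube c' \<in> t" if "c \<in> ?B" for c
  proof -
    have "cube_center c \<in> \<Union> t" 
      using that cell_in_box_iff[OF pos, of c] center_mem_iff[of c c] unfolding un by blast
    then obtain d where d: "d \<in> t" "cube_center c \<in> d" by blast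
    then obtain p q where pq: "adjacent p q" "d = basic_cube p \<union> basic_cube q" using dom by blast
    then have "c = p \<or> c = q" using d by (auto simp: center_mem_iff)
    then show ?thesis using pq d(1) adjacent_sym by (auto simp: Un_commute)
  qed
  \<comment> \<open>The choice is unique by \<open>eq\<close>: two dominoes of \<open>t\<close>
    containing the same cube share its centre as an interior point and hence coincide.\<close>
  define \<pi> where "\<pi> c = (SOME c'. adjacent c c' \<and> basic_cube c \<union> basic_cube c' \<in> t)" for c
  have \<pi>: "adjacent c (\<pi> c)" "piece \<pi> c \<in> t" if "c \<in> ?B" for c
    using someI_ex[OF ex[OF that]] unfolding \<pi>_def piece_def by auto
  have eq: "\<pi> c = c'" if "c \<in> ?B" "adjacent c c'" "basic_cube c \<union> basic_cube c' \<in> t" for c c'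
  proof -
    have "piece \<pi> c = basic_cube c \<union> basic_cube c'"
      using uniq[OF \<pi>(2)[OF that(1)] that(3), of c] by (auto simp: piece_def)
    then have "basic_cube (\<pi> c) \<subseteq> basic_cube c \<union> basic_cube c'" by (auto simp: piece_def)
    moreover have "\<pi> c \<noteq> c" using \<pi>(1)[OF that(1)] by (auto simp: adjacent_def)
    ultimately show ?thesis by (simp add: cube_subset_Un)
  qed
  have inB: "\<pi> c \<in> ?B" if "c \<in> ?B" for c
    using \<pi>(2)[OF that] un unfolding cell_in_box_iff[OF pos, symmetric] piece_def by blast
  have "cell_matching ?B \<pi>"
    unfolding cell_matching_def
  proof (intro ballI conjI)
    fix c assume c: "c \<in> ?B"
    show "\<pi> c \<in> ?B" "adjacent c (\<pi> c)" using inB \<pi> c by auto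
    show "\<pi> (\<pi> c) = c"
      by (rule eq) (use inB \<pi> c adjacent_sym in \<open>auto simp: piece_def Un_commute\<close>)
  qed
  moreover have "t = piece \<pi> ` ?B"
  proof (intro equalityI subsetI)
    fix d assume d: "d \<in> t"
    then obtain p q where pq: "adjacent p q" "d = basic_cube p \<union> basic_cube q" using dom by blast
    then have p: "p \<in> ?B" using un d unfolding cell_in_box_iff[OF pos, symmetric] by blast
    then have "\<pi> p = q" using eq pq d by blast
    then show "d \<in> piece \<pi> ` ?B" using p pq by (auto simp: piece_def)
  qed (use \<pi> in auto)
  ultimately show ?thesis using that by blast
qed

section \<open>Pretwists\<close>

definition lies_above :: "3 \<Rightarrow> int ^ 3 \<Rightarrow> int ^ 3 \<Rightarrow> bool" where
  "lies_above k p q \<longleftrightarrow> p $ k < q $ k \<and> (\<forall>j. j \<noteq> k \<longrightarrow> q $ j = p $ j)"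

definition real_vec :: "int ^ 3 \<Rightarrow> real ^ 3" where
  "real_vec p = (\<chi> i. real_of_int (p $ i))"

lemma real_vec_nth [simp]: "real_vec p $ i = real_of_int (p $ i)"
  by (simp add: real_vec_def)

lemma det_axis:
  obtains i j :: 3 where "i \<noteq> k" "j \<noteq> k" 
    "\<And>v w. det (vector [v, w, axis k 1] :: real ^ 3 ^ 3) = v $ i * w $ j - v $ j * w $ i"
proof -
  consider "k = 1" | "k = 2" | "k = 3" using exhaust_3 by blast
  then show ?thesis
  proof cases
    case 1
    show ?thesis by (rule that[of 2 3]) (simp_all add: 1 det_3 vector_3 axis_def)
  next
    case 2
    show ?thesis by (rule that[of 3 1]) (simp_all add: 2 det_3 vector_3 axis_def)
  next
    case 3
    show ?thesis by (rule that[of 1 2]) (simp_all add: 3 det_3 vector_3 axis_def)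
  qed
qed

lemma domino_cubes:
  assumes "adjacent p q" "white p"
  shows "white_cube (basic_cube p \<union> basic_cube q) = p" "black_cube (basic_cube p \<union> basic_cube q) = q"
    "domino_dir (basic_cube p \<union> basic_cube q) = real_vec (q - p)"
proof -
  have b: "black q" using assms adjacent_colour by blast
  show w: "white_cube (basic_cube p \<union> basic_cube q) = p"
    unfolding white_cube_def cube_subset_Un using assms(2) b by (intro the_equality) auto
  show b: "black_cube (basic_cube p \<union> basic_cube q) = q"
    unfolding black_cube_def cube_subset_Un using assms(2) b by (intro the_equality) auto
  show "domino_dir (basic_cube p \<union> basic_cube q) = real_vec (q - p)"
    unfolding domino_dir_def w b by (simp add: vec_eq_iff cube_center_def)
qed

text \<open>The domino is transversal to axis \<open>k\<close>, so a cell strictly above one of its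
  cells is outside it and has its interior in the shade. Conversely the shade is open, so a cell
  that meets it does so at an interior point, whose projection along \<open>k\<close> lies in only
  one square.\<close>

lemma shade_meets_iff:
  assumes "adjacent p p'" "p' $ k = p $ k"
  shows "(basic_cube q \<union> basic_cube q') \<inter> shade (axis k 1) (basic_cube p \<union> basic_cube p') \<noteq> {}
    \<longleftrightarrow> (\<exists>c0\<in>{p, p'}. \<exists>c1\<in>{q, q'}. lies_above k c0 c1)" (is "?meets \<longleftrightarrow> ?lies_above")
proof
  let ?d = "basic_cube p \<union> basic_cube p'"
  let ?S = "{x + s *\<^sub>R axis k 1 | x s. x \<in> ?d \<and> 0 \<le> s} - ?d"
  assume ?meets
  then obtain x c1 where x: "x \<in> interior ?S" "c1 \<in> {q, q'}" "x \<in> basic_cube c1"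
    unfolding shade_def by blast
  from open_meets_interior_cube[OF open_interior x(1,3)] obtain y where y: "y \<in> interior ?S" "y \<in> interior (basic_cube c1)"
    by blast
  then have "y \<in> ?S" using interior_subset by blast
  then obtain a s c0 where a: "y = a + s *\<^sub>R axis k 1" "0 \<le> s" "c0 \<in> {p, p'}" "a \<in> basic_cube c0" and nd: "y \<notin> ?d" by blast
  have y1: "real_of_int (c1 $ j) < y $ j" "y $ j < real_of_int (c1 $ j) + 1" for j
    using y(2) by (auto simp: mem_interior_basic_cube)
  have a1: "real_of_int (c0 $ j) \<le> a $ j" "a $ j \<le> real_of_int (c0 $ j) + 1" for j
    using a(4) by (auto simp: mem_basic_cube)
  have side: "c1 $ j = c0 $ j" if "j \<noteq> k" for j
  proof -
    have "y $ j = a $ j" using that by (simp add: a(1) axis_def)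
    then show ?thesis using y1[of j] a1[of j] by linarith
  qed
  have "a $ k \<le> y $ k" using a(2) by (simp add: a(1) axis_def)
  then have "c0 $ k \<le> c1 $ k" using y1[of k] a1[of k] by linarith
  moreover have "c0 $ k \<noteq> c1 $ k"
  proof
    assume "c0 $ k = c1 $ k"
    then have "c0 = c1" unfolding vec_eq_iff using side by metis
    then show False using nd a(3) y(2) interior_subset by blast
  qed
  ultimately have "lies_above k c0 c1" using side by (simp add: lies_above_def)
  then show ?lies_above using a(3) x(2) by blast
next
  let ?d = "basic_cube p \<union> basic_cube p'"
  let ?S = "{x + s *\<^sub>R axis k 1 | x s. x \<in> ?d \<and> 0 \<le> s} - ?d"
  assume ?lies_above
  then obtain c0 c1 where c: "c0 \<in> {p, p'}" "c1 \<in> {q, q'}" "lies_above k c0 c1" by blast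
  have "interior (basic_cube c1) \<subseteq> ?S"
  proof
    fix y assume y: "y \<in> interior (basic_cube c1)"
    let ?s = "real_of_int (c1 $ k - c0 $ k)"
    have "y - ?s *\<^sub>R axis k 1 \<in> basic_cube c0"
      unfolding mem_basic_cube
    proof
      fix j
      show "real_of_int (c0 $ j) \<le> (y - ?s *\<^sub>R axis k 1) $ j \<and> (y - ?s *\<^sub>R axis k 1) $ j \<le> real_of_int (c0 $ j) + 1"
        using y[unfolded mem_interior_basic_cube, rule_format, of j] c(3) 
        by (cases "j = k") (auto simp: axis_def lies_above_def)
    qed
    moreover have "0 \<le> ?s" using c(3) by (simp add: lies_above_def)
    moreover have "y = (y - ?s *\<^sub>R axis k 1) + ?s *\<^sub>R axis k 1" by simp
    ultimately have "\<exists>x s. y = x + s *\<^sub>R axis k 1 \<and> x \<in> ?d \<and> 0 \<le> s" using c(1) by blast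
    moreover have "y \<notin> ?d"
    proof
      assume "y \<in> ?d"
      then have "c1 \<in> {p, p'}" using interior_meets_cube[OF y] by blast
      then have "c1 $ k = c0 $ k" using c(1) assms(2) by auto
      then show False using c(3) by (simp add: lies_above_def)
    qed
    ultimately show "y \<in> ?S" by blast
  qed
  then have "interior (basic_cube c1) \<subseteq> interior ?S" by (simp add: interior_maximal)
  then have "cube_center c1 \<in> interior ?S" using center_interior by blast
  moreover have "cube_center c1 \<in> basic_cube q \<union> basic_cube q'" using c(2) center_mem_iff by blast
  ultimately show ?meets unfolding shade_def by blast
qed

text \<open>Passes from pairs of dominoes to pairs of cells. If the determinant is nonzero, both
  dominoes are transversal to \<open>k\<close> and perpendicular to each other, so their projections
  share at most one square and at most one of the four pairs of cells is aligned. If it is zero,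
  both sides vanish.\<close>

lemma effect_dominoes:
  fixes k :: 3
  assumes p: "adjacent p p'" "white p" and q: "adjacent q q'" "white q"
  defines "D \<equiv> det (vector [real_vec (q' - q), real_vec (p' - p), axis k 1] :: real ^ 3 ^ 3)"
  shows "effect (axis k 1) (basic_cube p \<union> basic_cube p') (basic_cube q \<union> basic_cube q')
    = 1 / 4 * (\<Sum>c0\<in>{p, p'}. \<Sum>c1\<in>{q, q'}. if lies_above k c0 c1 then D else 0)"
proof (cases "D = 0")
  case True
  then have "(\<Sum>c0\<in>{p, p'}. \<Sum>c1\<in>{q, q'}. if lies_above k c0 c1 then D else 0) = 0"
    by (intro sum.neutral ballI) simp
  then show ?thesis 
    unfolding effect_def domino_cubes(3)[OF p] domino_cubes(3)[OF q] D_def[symmetric] using True by simp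
next
  case False
  obtain i j where ij: "i \<noteq> k" "j \<noteq> k" 
    and det: "\<And>v w. det (vector [v, w, axis k 1] :: real ^ 3 ^ 3) = v $ i * w $ j - v $ j * w $ i"
    using det_axis by blast
  have D: "real_of_int ((q' $ i - q $ i) * (p' $ j - p $ j)) - real_of_int ((q' $ j - q $ j) * (p' $ i - p $ i)) \<noteq> 0"
    using False unfolding D_def det by simp
  then have "p' $ i \<noteq> p $ i \<or> p' $ j \<noteq> p $ j" by auto
  then have k: "p' $ k = p $ k" using p(1) ij unfolding adjacent_iff by metis
  have ne: "p \<noteq> p'" "q \<noteq> q'" using p q by (auto simp: adjacent_def)
  have ab: "c1 $ i = c0 $ i \<and> c1 $ j = c0 $ j" if "lies_above k c0 c1" for c0 c1
    using that ij by (simp add: lies_above_def)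
  have ex: "\<not> (lies_above k p q \<and> lies_above k p q')" "\<not> (lies_above k p' q \<and> lies_above k p' q')"
    "\<not> (lies_above k p q \<and> lies_above k p' q)" "\<not> (lies_above k p q' \<and> lies_above k p' q')"
    "\<not> (lies_above k p q \<and> lies_above k p' q')" "\<not> (lies_above k p q' \<and> lies_above k p' q)"
    using D ab[of p q] ab[of p q'] ab[of p' q] ab[of p' q'] by (auto simp: algebra_simps)
  have "(\<Sum>c0\<in>{p, p'}. \<Sum>c1\<in>{q, q'}. if lies_above k c0 c1 then D else 0) = 
    (if \<exists>c0\<in>{p, p'}. \<exists>c1\<in>{q, q'}. lies_above k c0 c1 then D else 0)"
    using ex ne by auto
  then show ?thesis
    unfolding effect_def domino_cubes(3)[OF p] domino_cubes(3)[OF q] D_def[symmetric] shade_meets_iff[OF p(1) k]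
    by simp
qed

text \<open>On a matched set both cells of a domino carry the direction from the white cube to the
  black one.\<close>

definition flow :: "(int ^ 3 \<Rightarrow> int ^ 3) \<Rightarrow> int ^ 3 \<Rightarrow> real ^ 3" where
  "flow \<pi> c = (if white c then real_vec (\<pi> c - c) else real_vec (c - \<pi> c))"

lemma sum_white_pairs:
  assumes m: "cell_matching B \<pi>" and fin: "finite B"
  shows "(\<Sum>c\<in>B. g c) = (\<Sum>p\<in>{c\<in>B. white c}. \<Sum>c\<in>{p, \<pi> p}. g c)"
proof -
  note m = m[unfolded cell_matching_def, rule_format]
  let ?W = "{c\<in>B. white c}" and ?K = "{c\<in>B. black c}"
  have "(\<Sum>c\<in>B. g c) = (\<Sum>c\<in>?W. g c) + (\<Sum>c\<in>?K. g c)"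
    by (subst sum.union_disjoint[symmetric]) (auto simp: fin intro: sum.cong)
  also have "(\<Sum>c\<in>?K. g c) = (\<Sum>p\<in>?W. g (\<pi> p))"
    by (rule sum.reindex_bij_witness[of _ \<pi> \<pi>]) (use m adjacent_colour in auto)
  also have "(\<Sum>c\<in>?W. g c) + (\<Sum>p\<in>?W. g (\<pi> p)) = (\<Sum>p\<in>?W. \<Sum>c\<in>{p, \<pi> p}. g c)"
    unfolding sum.distrib[symmetric]
  proof (rule sum.cong[OF refl])
    fix p assume "p \<in> ?W"
    then have "adjacent p (\<pi> p)" using m by auto
    then have "p \<noteq> \<pi> p" by (auto simp: adjacent_def)
    then show "g p + g (\<pi> p) = (\<Sum>c\<in>{p, \<pi> p}. g c)" by simp
  qed
  finally show ?thesis .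
qed

text \<open>Every domino is the piece of exactly one white cell. The sum over dominoes becomes one
  over white cells, and by \<open>effect_dominoes\<close> each white cell splits into the two cells
  of its domino.\<close>

lemma pretwist_matching:
  assumes cm: "cell_matching B \<pi>" and fin: "finite B"
  shows "pretwist (axis k 1) (piece \<pi> ` B) = 1 / 4 * (\<Sum>c0\<in>B. \<Sum>c1\<in>B.
    if lies_above k c0 c1 then det (vector [flow \<pi> c1, flow \<pi> c0, axis k 1] :: real ^ 3 ^ 3) else 0)"
proof -
  note m = cm[unfolded cell_matching_def, rule_format]
  let ?W = "{c\<in>B. white c}"
  have swap: "piece \<pi> (\<pi> c) = piece \<pi> c" if "c \<in> B" for c
    using m[OF that] by (simp add: piece_def Un_commute)
  have im: "piece \<pi> ` B = piece \<pi> ` ?W"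
  proof (intro equalityI subsetI)
    fix d assume "d \<in> piece \<pi> ` B"
    then obtain c where c: "c \<in> B" "d = piece \<pi> c" by blast
    show "d \<in> piece \<pi> ` ?W"
    proof (cases "white c")
      case False
      then have "\<pi> c \<in> ?W" using m[OF c(1)] adjacent_colour[of c "\<pi> c"] by simp
      then show ?thesis using swap[OF c(1)] c(2) by (metis imageI)
    qed (use c in auto)
  qed auto
  have inj: "inj_on (piece \<pi>) ?W"
  proof (rule inj_onI)
    fix a b assume ab: "a \<in> ?W" "b \<in> ?W" "piece \<pi> a = piece \<pi> b"
    then have "basic_cube a \<subseteq> basic_cube b \<union> basic_cube (\<pi> b)" by (auto simp: piece_def)
    then have "a = b \<or> a = \<pi> b" by (simp add: cube_subset_Un)
    moreover have "black (\<pi> b)" using ab(2) m adjacent_colour by auto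
    ultimately show "a = b" using ab(1) by auto
  qed
  have fl: "flow \<pi> c = real_vec (\<pi> p - p)" if "p \<in> ?W" "c \<in> {p, \<pi> p}" for p c
  proof -
    have "black (\<pi> p)" "\<pi> (\<pi> p) = p" using that(1) m adjacent_colour by auto
    then show ?thesis using that by (auto simp: flow_def)
  qed
  have "pretwist (axis k 1) (piece \<pi> ` B) = (\<Sum>p\<in>?W. \<Sum>q\<in>?W. effect (axis k 1) (piece \<pi> p) (piece \<pi> q))"
    unfolding pretwist_def sum.cartesian_product[symmetric] im by (simp add: sum.reindex[OF inj])
  also have "\<dots> = (\<Sum>p\<in>?W. \<Sum>q\<in>?W. 1 / 4 * (\<Sum>c0\<in>{p, \<pi> p}. \<Sum>c1\<in>{q, \<pi> q}. 
     if lies_above k c0 c1 then det (vector [flow \<pi> c1, flow \<pi> c0, axis k 1] :: real ^ 3 ^ 3) else 0))"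
  proof (rule sum.cong[OF refl], rule sum.cong[OF refl])
    fix p q assume pq: "p \<in> ?W" "q \<in> ?W"
    then have "adjacent p (\<pi> p)" "white p" "adjacent q (\<pi> q)" "white q" using m by auto
    note e = effect_dominoes[OF this, of k]
    have "(\<Sum>c0\<in>{p, \<pi> p}. \<Sum>c1\<in>{q, \<pi> q}. 
        if lies_above k c0 c1 then det (vector [flow \<pi> c1, flow \<pi> c0, axis k 1] :: real ^ 3 ^ 3) else 0)
      = (\<Sum>c0\<in>{p, \<pi> p}. \<Sum>c1\<in>{q, \<pi> q}. 
        if lies_above k c0 c1 then det (vector [real_vec (\<pi> q - q), real_vec (\<pi> p - p), axis k 1] :: real ^ 3 ^ 3) else 0)"
      by (rule sum.cong[OF refl], rule sum.cong[OF refl]) (simp only: fl[OF pq(1)] fl[OF pq(2)])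
    with e show "effect (axis k 1) (piece \<pi> p) (piece \<pi> q) = 1 / 4 * (\<Sum>c0\<in>{p, \<pi> p}. \<Sum>c1\<in>{q, \<pi> q}. 
     if lies_above k c0 c1 then det (vector [flow \<pi> c1, flow \<pi> c0, axis k 1] :: real ^ 3 ^ 3) else 0)"
      unfolding piece_def by (simp only:)
  qed
  also have "\<dots> = 1 / 4 * (\<Sum>p\<in>?W. \<Sum>c0\<in>{p, \<pi> p}. \<Sum>q\<in>?W. \<Sum>c1\<in>{q, \<pi> q}. 
     if lies_above k c0 c1 then det (vector [flow \<pi> c1, flow \<pi> c0, axis k 1] :: real ^ 3 ^ 3) else 0)"
    unfolding sum_distrib_left[symmetric] by (intro arg_cong[of _ _ "(*) (1 / 4)"] sum.cong refl sum.swap)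
  finally show ?thesis
    unfolding sum_white_pairs[OF cm fin] .
qed

section \<open>Matchings in coordinates\<close>

abbreviation cell :: "int \<Rightarrow> int \<Rightarrow> int \<Rightarrow> int ^ 3" where
  "cell x y z \<equiv> vector [x, y, z]"

lemma cell_nth [simp]: "cell x y z $ 1 = x" "cell x y z $ 2 = y" "cell x y z $ 3 = z"
  by (simp_all add: vector_3)

lemma cell_eta: "cell (c $ 1) (c $ 2) (c $ 3) = c"
  by (simp add: vec_eq_iff forall_3)

definition partner :: "(int \<Rightarrow> int \<Rightarrow> int \<Rightarrow> int \<times> int \<times> int) \<Rightarrow> int ^ 3 \<Rightarrow> int ^ 3" where
  "partner w p = (case w (p $ 1) (p $ 2) (p $ 3) of (a, b, c) \<Rightarrow> cell (p $ 1 + a) (p $ 2 + b) (p $ 3 + c))"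

lemma mem_cells: "p \<in> cells L M N \<longleftrightarrow> in_box (int L) (int M) (int N) (p $ 1) (p $ 2) (p $ 3)"
  by (auto simp: cells_def in_box_def)

lemma cell_matching_partner:
  assumes "pairing (int L) (int M) (int N) w"
  shows "cell_matching (cells L M N) (partner w)"
  unfolding cell_matching_def
proof
  fix p assume "p \<in> cells L M N"
  then have b: "in_box (int L) (int M) (int N) (p $ 1) (p $ 2) (p $ 3)" by (simp add: mem_cells)
  obtain a b c where w: "w (p $ 1) (p $ 2) (p $ 3) = (a, b, c)" by (metis prod_cases3)
  note D = pairingD[OF assms b w]
  have e: "partner w p = cell (p $ 1 + a) (p $ 2 + b) (p $ 3 + c)" by (simp add: partner_def w)
  moreover have "partner w (cell (p $ 1 + a) (p $ 2 + b) (p $ 3 + c)) = p"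
    unfolding partner_def using D(3) by (simp add: cell_eta)
  ultimately show "partner w p \<in> cells L M N \<and> partner w (partner w p) = p \<and> adjacent p (partner w p)"
    using D(1,2) by (simp add: mem_cells adjacent_def)
qed

lemma pairing_of_cell_matching:
  assumes "cell_matching (cells L M N) \<pi>"
  obtains w where "pairing (int L) (int M) (int N) w" "partner w = \<pi>"
proof -
  note m = assms[unfolded cell_matching_def, rule_format]
  define w where "w x y z = (let p = \<pi> (cell x y z) in (p $ 1 - x, p $ 2 - y, p $ 3 - z))" for x y z
  have "pairing (int L) (int M) (int N) w"
    unfolding pairing_def
  proof (intro allI impI, elim conjE)
    fix x y z a b c
    assume b: "in_box (int L) (int M) (int N) x y z" and "w x y z = (a, b, c)"
    then have p: "\<pi> (cell x y z) = cell (x + a) (y + b) (z + c)"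
      by (subst cell_eta[symmetric]) (auto simp: w_def Let_def)
    have "cell x y z \<in> cells L M N" using b by (simp add: mem_cells)
    from m[OF this] show "\<bar>a\<bar> + \<bar>b\<bar> + \<bar>c\<bar> = 1 \<and> in_box (int L) (int M) (int N) (x + a) (y + b) (z + c) \<and>
       w (x + a) (y + b) (z + c) = (- a, - b, - c)"
      unfolding p by (simp add: mem_cells adjacent_def w_def)
  qed
  moreover have "partner w = \<pi>"
    by (rule ext) (simp add: partner_def w_def Let_def cell_eta)
  ultimately show ?thesis using that by blast
qed

lemma sum_cells:
  "(\<Sum>p\<in>cells L M N. f p) = (\<Sum>x\<in>{0..<int L}. \<Sum>y\<in>{0..<int M}. \<Sum>z\<in>{0..<int N}. f (cell x y z))"
  unfolding sum.cartesian_product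
  by (rule sum.reindex_bij_witness[of _ "\<lambda>(x, y, z). cell x y z" "\<lambda>p. (p $ 1, p $ 2, p $ 3)"])
    (auto simp: mem_cells in_box_def cell_eta)

lemma finite_cells: "finite (cells L M N)"
proof -
  have "cells L M N \<subseteq> (\<lambda>(x, y, z). cell x y z) ` ({0..<int L} \<times> {0..<int M} \<times> {0..<int N})"
  proof
    fix p assume "p \<in> cells L M N"
    then show "p \<in> (\<lambda>(x, y, z). cell x y z) ` ({0..<int L} \<times> {0..<int M} \<times> {0..<int N})"
      by (intro rev_image_eqI[of "(p $ 1, p $ 2, p $ 3)"]) (auto simp: cells_def cell_eta)
  qed
  then show ?thesis by (rule finite_subset) simp
qed

lemma sum_above:
  fixes g :: "int ^ 3 \<Rightarrow> real"
  assumes "cell x y z \<in> cells L M N"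
  shows "(\<Sum>q\<in>cells L M N. if lies_above 1 (cell x y z) q then g q else 0) = (\<Sum>x'\<in>{0..<int L}. if x < x' then g (cell x' y z) else 0)"
    and "(\<Sum>q\<in>cells L M N. if lies_above 2 (cell x y z) q then g q else 0) = (\<Sum>y'\<in>{0..<int M}. if y < y' then g (cell x y' z) else 0)"
    and "(\<Sum>q\<in>cells L M N. if lies_above 3 (cell x y z) q then g q else 0) = (\<Sum>z'\<in>{0..<int N}. if z < z' then g (cell x y z') else 0)"
proof -
  have eta: "cell (q $ 1) y z = q" if "q $ 2 = y" "q $ 3 = z" for q y z using that cell_eta[of q] by simp
  have eta2: "cell x (q $ 2) z = q" if "q $ 1 = x" "q $ 3 = z" for q x z using that cell_eta[of q] by simp
  have eta3: "cell x y (q $ 3) = q" if "q $ 1 = x" "q $ 2 = y" for q x y using that cell_eta[of q] by simp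
  show "(\<Sum>q\<in>cells L M N. if lies_above 1 (cell x y z) q then g q else 0) = (\<Sum>x'\<in>{0..<int L}. if x < x' then g (cell x' y z) else 0)"
    unfolding sum.inter_filter[OF finite_cells, symmetric] sum.inter_filter[OF finite_atLeastLessThan_int, symmetric]
    by (rule sum.reindex_bij_witness[of _ "\<lambda>x'. cell x' y z" "\<lambda>q. q $ 1"])
      (use assms in \<open>auto simp: lies_above_def forall_3 mem_cells in_box_def eta\<close>)
  show "(\<Sum>q\<in>cells L M N. if lies_above 2 (cell x y z) q then g q else 0) = (\<Sum>y'\<in>{0..<int M}. if y < y' then g (cell x y' z) else 0)"
    unfolding sum.inter_filter[OF finite_cells, symmetric] sum.inter_filter[OF finite_atLeastLessThan_int, symmetric]
    by (rule sum.reindex_bij_witness[of _ "\<lambda>y'. cell x y' z" "\<lambda>q. q $ 2"])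
      (use assms in \<open>auto simp: lies_above_def forall_3 mem_cells in_box_def eta2\<close>)
  show "(\<Sum>q\<in>cells L M N. if lies_above 3 (cell x y z) q then g q else 0) = (\<Sum>z'\<in>{0..<int N}. if z < z' then g (cell x y z') else 0)"
    unfolding sum.inter_filter[OF finite_cells, symmetric] sum.inter_filter[OF finite_atLeastLessThan_int, symmetric]
    by (rule sum.reindex_bij_witness[of _ "\<lambda>z'. cell x y z'" "\<lambda>q. q $ 3"])
      (use assms in \<open>auto simp: lies_above_def forall_3 mem_cells in_box_def eta3\<close>)
qed

text \<open>Exchanging the names of \<open>z\<close> and \<open>z'\<close> in the second product
  moves it to the pairs in reverse order, where \<open>sgn\<close> supplies its minus sign.\<close>

lemma sum_ordered_pairs:
  fixes A B :: "int \<Rightarrow> int"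
  shows "(\<Sum>z\<in>I. \<Sum>z'\<in>I. if z < z' then A z' * B z - B z' * A z else 0) = (\<Sum>z\<in>I. \<Sum>z'\<in>I. sgn (z' - z) * A z' * B z)"
proof -
  have "(\<Sum>z\<in>I. \<Sum>z'\<in>I. sgn (z' - z) * A z' * B z) 
     = (\<Sum>z\<in>I. \<Sum>z'\<in>I. if z < z' then A z' * B z else 0) - (\<Sum>z\<in>I. \<Sum>z'\<in>I. if z' < z then A z' * B z else 0)"
    unfolding sum_subtractf[symmetric] by (auto simp: sgn_if intro!: sum.cong)
  also have "(\<Sum>z\<in>I. \<Sum>z'\<in>I. if z' < z then A z' * B z else 0) = (\<Sum>z\<in>I. \<Sum>z'\<in>I. if z < z' then A z * B z' else 0)"
    by (rule sum.swap)
  finally show ?thesis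
    unfolding sum_subtractf[symmetric] by (auto intro!: sum.cong)
qed

lemma flow_partner:
  assumes "w x y z = (a, b, c)"
  shows "flow (partner w) (cell x y z) $ 1 = real_of_int (colour (x + y + z) * a)"
    "flow (partner w) (cell x y z) $ 2 = real_of_int (colour (x + y + z) * b)"
    "flow (partner w) (cell x y z) $ 3 = real_of_int (colour (x + y + z) * c)"
  by (simp_all add: flow_def partner_def assms white_def colour_def)

text \<open>Along an axis the determinant is the 2 by 2 minor of the two following components in
  cyclic order; \<open>sum_ordered_pairs\<close> makes it the \<open>column\<close> of the box
  rotated until that axis is the third.\<close>

lemma pretwist_axes:
  assumes w: "pairing (int L) (int M) (int N) w"
  shows "pretwist (axis 3 1) (piece (partner w) ` cells L M N) = real_of_int (ztwist (int L) (int M) (int N) w) / 4"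
    and "pretwist (axis 1 1) (piece (partner w) ` cells L M N) = real_of_int (ztwist (int M) (int N) (int L) (cycle_axes w)) / 4"
    and "pretwist (axis 2 1) (piece (partner w) ` cells L M N) = real_of_int (ztwist (int N) (int L) (int M) (cycle_axes (cycle_axes w))) / 4"
proof -
  define A where "A x y z = colour (x + y + z) * fst (w x y z)" for x y z
  define B where "B x y z = colour (x + y + z) * fst (snd (w x y z))" for x y z
  define C where "C x y z = colour (x + y + z) * snd (snd (w x y z))" for x y z
  have fl: "flow (partner w) (cell x y z) $ 1 = real_of_int (A x y z)"
    "flow (partner w) (cell x y z) $ 2 = real_of_int (B x y z)"
    "flow (partner w) (cell x y z) $ 3 = real_of_int (C x y z)" for x y z
    using flow_partner[of w x y z "fst (w x y z)" "fst (snd (w x y z))" "snd (snd (w x y z))"]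
    by (simp_all add: A_def B_def C_def)
  have mem: "cell x y z \<in> cells L M N" if "x \<in> {0..<int L}" "y \<in> {0..<int M}" "z \<in> {0..<int N}" for x y z
    using that by (simp add: mem_cells in_box_def)
  note pt = pretwist_matching[OF cell_matching_partner[OF w] finite_cells]
  let ?X = "{0..<int L}" and ?Y = "{0..<int M}" and ?Z = "{0..<int N}"
  have "pretwist (axis 3 1) (piece (partner w) ` cells L M N) = 1 / 4 * (\<Sum>x\<in>?X. \<Sum>y\<in>?Y. \<Sum>z\<in>?Z. \<Sum>z'\<in>?Z.
      if z < z' then real_of_int (A x y z' * B x y z - B x y z' * A x y z) else 0)"
    unfolding pt sum_cells[of _ L M N]
    by (rule arg_cong[of _ _ "(*) (1 / 4)"], rule sum.cong[OF refl], rule sum.cong[OF refl], rule sum.cong[OF refl], subst sum_cells[symmetric], subst sum_above(3)[OF mem])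
      (auto intro!: sum.cong simp: det_3 axis_def vector_3 fl)
  also have "\<dots> = 1 / 4 * real_of_int (\<Sum>x\<in>?X. \<Sum>y\<in>?Y. \<Sum>z\<in>?Z. \<Sum>z'\<in>?Z.
      if z < z' then A x y z' * B x y z - B x y z' * A x y z else 0)"
    by (simp add: if_distrib cong: if_cong)
  also have "(\<Sum>x\<in>?X. \<Sum>y\<in>?Y. \<Sum>z\<in>?Z. \<Sum>z'\<in>?Z. if z < z' then A x y z' * B x y z - B x y z' * A x y z else 0)
     = ztwist (int L) (int M) (int N) w"
    unfolding ztwist_def column_def sum_ordered_pairs
    by (intro sum.cong refl) (auto simp: A_def B_def colour_def)
  finally show "pretwist (axis 3 1) (piece (partner w) ` cells L M N) = real_of_int (ztwist (int L) (int M) (int N) w) / 4"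
    by simp
  have "pretwist (axis 1 1) (piece (partner w) ` cells L M N) = 1 / 4 * (\<Sum>x\<in>?X. \<Sum>y\<in>?Y. \<Sum>z\<in>?Z. \<Sum>x'\<in>?X.
      if x < x' then real_of_int (B x' y z * C x y z - C x' y z * B x y z) else 0)"
    unfolding pt sum_cells[of _ L M N]
    by (rule arg_cong[of _ _ "(*) (1 / 4)"], rule sum.cong[OF refl], rule sum.cong[OF refl], rule sum.cong[OF refl], subst sum_cells[symmetric], subst sum_above(1)[OF mem])
      (auto intro!: sum.cong simp: det_3 axis_def vector_3 fl)
  also have "\<dots> = 1 / 4 * real_of_int (\<Sum>x\<in>?X. \<Sum>y\<in>?Y. \<Sum>z\<in>?Z. \<Sum>x'\<in>?X.
      if x < x' then B x' y z * C x y z - C x' y z * B x y z else 0)"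
    by (simp add: if_distrib cong: if_cong)
  also have "(\<Sum>x\<in>?X. \<Sum>y\<in>?Y. \<Sum>z\<in>?Z. \<Sum>x'\<in>?X. if x < x' then B x' y z * C x y z - C x' y z * B x y z else 0)
    = (\<Sum>y\<in>?Y. \<Sum>z\<in>?Z. \<Sum>x\<in>?X. \<Sum>x'\<in>?X. if x < x' then B x' y z * C x y z - C x' y z * B x y z else 0)"
    by (subst sum.swap, rule sum.cong[OF refl], rule sum.swap)
  also have "\<dots> = ztwist (int M) (int N) (int L) (cycle_axes w)"
    unfolding ztwist_def column_def sum_ordered_pairs[of "\<lambda>x. B x _ _" "\<lambda>x. C x _ _"]
    by (intro sum.cong refl) (auto simp: B_def C_def colour_def cycle_axes_def case_prod_beta)
  finally show "pretwist (axis 1 1) (piece (partner w) ` cells L M N) = real_of_int (ztwist (int M) (int N) (int L) (cycle_axes w)) / 4"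
    by simp
  have "pretwist (axis 2 1) (piece (partner w) ` cells L M N) = 1 / 4 * (\<Sum>x\<in>?X. \<Sum>y\<in>?Y. \<Sum>z\<in>?Z. \<Sum>y'\<in>?Y.
      if y < y' then real_of_int (C x y' z * A x y z - A x y' z * C x y z) else 0)"
    unfolding pt sum_cells[of _ L M N]
    by (rule arg_cong[of _ _ "(*) (1 / 4)"], rule sum.cong[OF refl], rule sum.cong[OF refl], rule sum.cong[OF refl], subst sum_cells[symmetric], subst sum_above(2)[OF mem])
      (auto intro!: sum.cong simp: det_3 axis_def vector_3 fl)
  also have "\<dots> = 1 / 4 * real_of_int (\<Sum>x\<in>?X. \<Sum>y\<in>?Y. \<Sum>z\<in>?Z. \<Sum>y'\<in>?Y.
      if y < y' then C x y' z * A x y z - A x y' z * C x y z else 0)"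
    by (simp add: if_distrib cong: if_cong)
  also have "(\<Sum>x\<in>?X. \<Sum>y\<in>?Y. \<Sum>z\<in>?Z. \<Sum>y'\<in>?Y. if y < y' then C x y' z * A x y z - A x y' z * C x y z else 0)
    = (\<Sum>x\<in>?X. \<Sum>z\<in>?Z. \<Sum>y\<in>?Y. \<Sum>y'\<in>?Y. if y < y' then C x y' z * A x y z - A x y' z * C x y z else 0)"
    by (rule sum.cong[OF refl], rule sum.swap)
  also have "\<dots> = (\<Sum>z\<in>?Z. \<Sum>x\<in>?X. \<Sum>y\<in>?Y. \<Sum>y'\<in>?Y. if y < y' then C x y' z * A x y z - A x y' z * C x y z else 0)"
    by (rule sum.swap)
  also have "\<dots> = ztwist (int N) (int L) (int M) (cycle_axes (cycle_axes w))"
    unfolding ztwist_def column_def sum_ordered_pairs[of "\<lambda>y. C _ y _" "\<lambda>y. A _ y _"]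
    by (intro sum.cong refl) (auto simp: A_def C_def colour_def cycle_axes_def case_prod_beta)
  finally show "pretwist (axis 2 1) (piece (partner w) ` cells L M N) = real_of_int (ztwist (int N) (int L) (int M) (cycle_axes (cycle_axes w))) / 4"
    by simp
qed

section \<open>Maximal twist\<close>

definition tiling_of :: "nat \<Rightarrow> nat \<Rightarrow> nat \<Rightarrow> (int \<Rightarrow> int \<Rightarrow> int \<Rightarrow> int \<times> int \<times> int) \<Rightarrow> (real ^ 3) set set" where
  "tiling_of L M N w = piece (partner w) ` cells L M N"

lemma twist_tiling_of:
  assumes w: "pairing (int L) (int M) (int N) w"
  shows "twist (tiling_of L M N w) = real_of_int (ztwist (int L) (int M) (int N) w) / 4"
proof -
  have "ztwist (int M) (int N) (int L) (cycle_axes w) = ztwist (int L) (int M) (int N) w"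
    "ztwist (int N) (int L) (int M) (cycle_axes (cycle_axes w)) = ztwist (int L) (int M) (int N) w"
    using ztwist_cycle_axes[OF w] ztwist_cycle_axes[OF pairing_cycle_axes[OF w]] by simp_all
  then have "\<forall>k. pretwist (axis k 1) (tiling_of L M N w) = real_of_int (ztwist (int L) (int M) (int N) w) / 4"
    unfolding forall_3 tiling_of_def using pretwist_axes[OF w] by simp
  then show ?thesis unfolding twist_def by (intro the_equality) auto
qed

lemma tiling_iff:
  assumes "0 < L" "0 < M" "0 < N"
  shows "tiling (lattice_box L M N) t \<longleftrightarrow> (\<exists>w. pairing (int L) (int M) (int N) w \<and> t = tiling_of L M N w)"
proof
  assume "tiling (lattice_box L M N) t"
  then obtain \<pi> where \<pi>: "cell_matching (cells L M N) \<pi>" "t = piece \<pi> ` cells L M N"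
    using matching_of_tiling assms by blast
  from pairing_of_cell_matching[OF \<pi>(1)] obtain w where "pairing (int L) (int M) (int N) w" "partner w = \<pi>" .
  then show "\<exists>w. pairing (int L) (int M) (int N) w \<and> t = tiling_of L M N w"
    using \<pi>(2) unfolding tiling_of_def by blast
next
  assume "\<exists>w. pairing (int L) (int M) (int N) w \<and> t = tiling_of L M N w"
  then show "tiling (lattice_box L M N) t"
    unfolding tiling_of_def using tiling_of_matching[OF cell_matching_partner assms] by blast
qed

lemma twists_eq:
  assumes "0 < L" "0 < M" "0 < N"
  shows "{twist t | t. tiling (lattice_box L M N) t} =
    {real_of_int (ztwist (int L) (int M) (int N) w) / 4 | w. pairing (int L) (int M) (int N) w}"
  (is "?T = ?W")
proof (intro equalityI subsetI)
  fix c assume "c \<in> ?T"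
  then obtain w where "pairing (int L) (int M) (int N) w" "c = twist (tiling_of L M N w)"
    unfolding tiling_iff[OF assms] by blast
  then show "c \<in> ?W" using twist_tiling_of by blast
next
  fix c assume "c \<in> ?W"
  then obtain w where w: "pairing (int L) (int M) (int N) w" "c = real_of_int (ztwist (int L) (int M) (int N) w) / 4"
    by blast
  then have "c = twist (tiling_of L M N w)" using twist_tiling_of[OF w(1)] by simp
  then show "c \<in> ?T" using w(1) unfolding tiling_iff[OF assms] by blast
qed

lemma finite_tilings:
  assumes "0 < L" "0 < M" "0 < N"
  shows "finite {t. tiling (lattice_box L M N) t}"
proof (rule finite_subset)
  let ?B = "cells L M N"
  show "{t. tiling (lattice_box L M N) t} \<subseteq> Pow ((\<lambda>(p, q). basic_cube p \<union> basic_cube q) ` (?B \<times> ?B))"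
  proof
    fix t assume "t \<in> {t. tiling (lattice_box L M N) t}"
    then obtain \<pi> where "cell_matching ?B \<pi>" "t = piece \<pi> ` ?B"
      using matching_of_tiling assms by blast
    moreover have "piece \<pi> c = (\<lambda>(p, q). basic_cube p \<union> basic_cube q) (c, \<pi> c)" for c
      by (simp add: piece_def)
    ultimately show "t \<in> Pow ((\<lambda>(p, q). basic_cube p \<union> basic_cube q) ` (?B \<times> ?B))"
      unfolding cell_matching_def by blast
  qed
  show "finite (Pow ((\<lambda>(p, q). basic_cube p \<union> basic_cube q) ` (?B \<times> ?B)))"
    by (simp add: finite_cells)
qed

lemma finite_twists:
  assumes "0 < L" "0 < M" "0 < N"
  shows "finite {twist t | t. tiling (lattice_box L M N) t}"
  using finite_imageI[OF finite_tilings[OF assms], of twist] by (simp add: setcompr_eq_image)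

lemma maxtw_lower:
  assumes "0 < L" "0 < M" "0 < N" "attains L M N k"
  shows "real_of_int k / 4 \<le> maxtw L M N"
proof -
  obtain w where "pairing (int L) (int M) (int N) w" "k \<le> ztwist (int L) (int M) (int N) w"
    using assms(4) by (auto simp: attains_def)
  then have "real_of_int k / 4 \<le> real_of_int (ztwist (int L) (int M) (int N) w) / 4"
    "real_of_int (ztwist (int L) (int M) (int N) w) / 4 \<in> {twist t | t. tiling (lattice_box L M N) t}"
    unfolding twists_eq[OF assms(1-3)] by auto
  then show ?thesis unfolding maxtw_def using Max_ge[OF finite_twists[OF assms(1-3)]] order_trans by blast
qed

text \<open>An even volume guarantees that a tiling exists, so the maximum is taken over a nonempty
  set.\<close>

lemma maxtw_attained:
  assumes "0 < L" "0 < M" "0 < N" "even (L * M * N)"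
  obtains w where "pairing (int L) (int M) (int N) w" "maxtw L M N = real_of_int (ztwist (int L) (int M) (int N) w) / 4"
proof -
  have "{twist t | t. tiling (lattice_box L M N) t} \<noteq> {}"
    unfolding twists_eq[OF assms(1-3)] using attains_zero[OF assms(4)] unfolding attains_def by blast
  from Max_in[OF finite_twists[OF assms(1-3)] this] show ?thesis
    unfolding maxtw_def[symmetric] unfolding twists_eq[OF assms(1-3)] using that by auto
qed

lemma maxtw_upper:
  assumes "0 < L" "0 < M" "0 < N" "even (L * M * N)"
  shows "maxtw L M N \<le> 1 / 16 * real (L * M * N * min L (min M N))"
proof -
  from maxtw_attained[OF assms] obtain w where w: "pairing (int L) (int M) (int N) w" 
    and m: "maxtw L M N = real_of_int (ztwist (int L) (int M) (int N) w) / 4" .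
  note w1 = pairing_cycle_axes[OF w]
  note w2 = pairing_cycle_axes[OF w1]
  have eq: "ztwist (int M) (int N) (int L) (cycle_axes w) = ztwist (int L) (int M) (int N) w"
    "ztwist (int N) (int L) (int M) (cycle_axes (cycle_axes w)) = ztwist (int L) (int M) (int N) w"
    using ztwist_cycle_axes[OF w] ztwist_cycle_axes[OF w1] by simp_all
  \<comment> \<open>One bound for each direction of the lines; the best of the three has the
    smallest side as its last factor.\<close>
  have "4 * ztwist (int L) (int M) (int N) w \<le> int (L * M * N * N)"
    "4 * ztwist (int L) (int M) (int N) w \<le> int (L * M * N * L)"
    "4 * ztwist (int L) (int M) (int N) w \<le> int (L * M * N * M)"
    using ztwist_upper[OF w] ztwist_upper[OF w1] ztwist_upper[OF w2] unfolding eq by (simp_all add: mult_ac)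
  then have "4 * ztwist (int L) (int M) (int N) w \<le> int (L * M * N * min L (min M N))"
    by (simp add: min_def)
  then have "real_of_int (4 * ztwist (int L) (int M) (int N) w) \<le> real_of_int (int (L * M * N * min L (min M N)))"
    by (simp only: of_int_le_iff)
  then show ?thesis unfolding m by simp
qed

lemma maxtw_upper_cube:
  assumes "0 < n" "even n"
  shows "maxtw n n n \<le> 1 / 24 * real (n * n * n * n)"
proof -
  have "even (n * n * n)" using assms(2) by simp
  from maxtw_attained[OF assms(1,1,1) this] obtain w where w: "pairing (int n) (int n) (int n) w" 
    and m: "maxtw n n n = real_of_int (ztwist (int n) (int n) (int n) w) / 4" .
  have "6 * ztwist (int n) (int n) (int n) w \<le> int (n * n * n * n)" using ztwist_upper_cube[OF w] by simp
  then have "real_of_int (6 * ztwist (int n) (int n) (int n) w) \<le> real_of_int (int (n * n * n * n))"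
    by (simp only: of_int_le_iff)
  then show ?thesis unfolding m by simp
qed

section \<open>Limits over growing boxes\<close>

lemma eventually_boxes_to_infinity:
  "eventually (\<lambda>(L, M, N). 0 < L \<and> 0 < M \<and> 0 < N \<and> even (L * M * N)) boxes_to_infinity"
proof -
  have "eventually (\<lambda>p. 0 < fst p \<and> 0 < fst (snd p) \<and> 0 < snd (snd p)) 
      (at_top \<times>\<^sub>F at_top \<times>\<^sub>F at_top :: (nat \<times> nat \<times> nat) filter)"
    by (intro eventually_prodI[of "\<lambda>x. 0 < x" _ "\<lambda>p. 0 < fst p \<and> 0 < snd p"] 
        eventually_prodI eventually_gt_at_top)
  then show ?thesis
    unfolding boxes_to_infinity_def eventually_inf_principal by eventually_elim auto
qed

lemma filterlim_boxes_to_infinity: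
  assumes "filterlim f at_top sequentially" "filterlim g at_top sequentially" "filterlim h at_top sequentially"
    and "\<And>n. even (f n) \<or> even (g n) \<or> even (h n)"
  shows "filterlim (\<lambda>n. (f n, g n, h n)) boxes_to_infinity sequentially"
  unfolding boxes_to_infinity_def filterlim_inf filterlim_principal
  using assms by (auto intro!: filterlim_Pair)

lemma Limsup_subfilter: "filterlim g F G \<Longrightarrow> Limsup G (\<lambda>n. f (g n)) \<le> Limsup F f"
  for f :: "'a \<Rightarrow> 'b::complete_lattice"
  unfolding Limsup_def filterlim_iff
  by (rule INF_greatest) (auto intro!: INF_lower2 SUP_mono)

lemma Liminf_subfilter: "filterlim g F G \<Longrightarrow> Liminf F f \<le> Liminf G (\<lambda>n. f (g n))"
  for f :: "'a \<Rightarrow> 'b::complete_lattice"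
  unfolding Liminf_def filterlim_iff
  by (rule SUP_least) (auto intro!: SUP_upper2 INF_mono)

lemma maxtw_ratio_le:
  assumes "0 < L" "0 < M" "0 < N" "maxtw L M N \<le> c * real (L * M * N * min L (min M N))"
  shows "maxtw_ratio L M N \<le> c"
  unfolding maxtw_ratio_def using assms by (subst pos_divide_le_eq) auto

text \<open>The tubes with c = n^2, t = n, l = n^3 and h = 2 n. The choice h = 2 t makes bar columns
  half shell and half core; c / t and l / c both tend to infinity, so walls and ends become
  negligible. Each of these two losses costs a factor n / (n + 2).\<close>

lemma maxtw_ratio_tubes:
  assumes "2 \<le> n"
  shows "1 / 16 * (real n / (real n + 2))\<^sup>2 \<le> maxtw_ratio (2 * n ^ 2 + 4 * n) (n ^ 3 + 2 * n ^ 2) (4 * n)"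
proof -
  define x where "x = real n"
  have x: "2 \<le> x" using assms by (simp add: x_def)
  have "attains (2 * n ^ 2 + 4 * n) (n ^ 3 + 2 * n ^ 2) (4 * n) (int (4 * n ^ 3 * n * n ^ 2 * (2 * n)))"
    using attains_tubes[of "n ^ 2" n "n ^ 3" "2 * n"] by simp
  from maxtw_lower[OF _ _ _ this] assms
  have *: "2 * x ^ 7 \<le> maxtw (2 * n ^ 2 + 4 * n) (n ^ 3 + 2 * n ^ 2) (4 * n)"
    by (simp add: x_def power_numeral_reduce mult_ac)
  have "2 * n \<le> n ^ 2" "2 * n ^ 2 \<le> n ^ 3"
    using assms mult_le_mono1[OF assms, of n] mult_le_mono1[OF assms, of "n ^ 2"]
    by (simp_all add: power2_eq_square power3_eq_cube mult_ac)
  then have "4 * n \<le> n ^ 3 + 2 * n ^ 2" by linarith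
  then have "min (2 * n ^ 2 + 4 * n) (min (n ^ 3 + 2 * n ^ 2) (4 * n)) = 4 * n" by simp
  then have denom: "real ((2 * n ^ 2 + 4 * n) * (n ^ 3 + 2 * n ^ 2) * (4 * n) * 
      min (2 * n ^ 2 + 4 * n) (min (n ^ 3 + 2 * n ^ 2) (4 * n)))
    = (2 * x * (x + 2)) * (x ^ 2 * (x + 2)) * (4 * x) * (4 * x)" (is "_ = ?Q")
    by (simp only: x_def) (simp add: power_numeral_reduce algebra_simps)
  have "x \<noteq> 0" "x + 2 \<noteq> 0" using x by auto
  then have "1 / 16 * (x / (x + 2))\<^sup>2 = 2 * x ^ 7 / ?Q"
    by (simp add: divide_simps) (simp add: power_numeral_reduce)
  also have "\<dots> \<le> maxtw (2 * n ^ 2 + 4 * n) (n ^ 3 + 2 * n ^ 2) (4 * n) / ?Q"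
    using * x by (intro divide_right_mono) auto
  finally show ?thesis
    unfolding maxtw_ratio_def denom by (simp add: x_def)
qed

lemma Limsup_maxtw_ratio:
  "Limsup boxes_to_infinity (\<lambda>(L, M, N). ereal (maxtw_ratio L M N)) = ereal (1 / 16)"
proof (rule antisym)
  have "eventually (\<lambda>p. (\<lambda>(L, M, N). ereal (maxtw_ratio L M N)) p \<le> ereal (1 / 16)) boxes_to_infinity"
    using eventually_boxes_to_infinity
  proof eventually_elim
    case (elim p)
    obtain L M N where p: "p = (L, M, N)" by (metis prod_cases3)
    have "maxtw_ratio L M N \<le> 1 / 16"
      using elim unfolding p by (intro maxtw_ratio_le maxtw_upper) auto
    then show ?case by (simp add: p)
  qed
  then show "Limsup boxes_to_infinity (\<lambda>(L, M, N). ereal (maxtw_ratio L M N)) \<le> ereal (1 / 16)"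
    by (rule Limsup_bounded)
  let ?b = "\<lambda>n. (2 * n ^ 2 + 4 * n, n ^ 3 + 2 * n ^ 2, 4 * n) :: nat \<times> nat \<times> nat"
  have "filterlim (\<lambda>n. k * n + m n) at_top sequentially" if "0 < k" for k :: nat and m
    by (rule filterlim_at_top_mono[OF filterlim_ident]) (use that in \<open>auto intro!: always_eventually trans_le_add1\<close>)
  note lim = this[of 4 "\<lambda>n. 2 * n ^ 2"] this[of 1 "\<lambda>n. n ^ 3 + 2 * n ^ 2 - n"] this[of 4 "\<lambda>n. 0"]
  \<comment> \<open>Each side is put in the form \<open>k * n + m n\<close> with positive
    \<open>k\<close> to see that it tends to infinity; here the subtraction on the naturals does not
    truncate.\<close>
  have "n + (n ^ 3 + 2 * n ^ 2 - n) = n ^ 3 + 2 * n ^ 2" for n :: nat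
    by (cases n) (simp_all add: power2_eq_square)
  then have "filterlim ?b boxes_to_infinity sequentially"
    using lim by (intro filterlim_boxes_to_infinity) (simp_all add: add.commute)
  from Limsup_subfilter[OF this, of "\<lambda>(L, M, N). ereal (maxtw_ratio L M N)"]
  have "Limsup sequentially (\<lambda>n. ereal (maxtw_ratio (2 * n ^ 2 + 4 * n) (n ^ 3 + 2 * n ^ 2) (4 * n)))
    \<le> Limsup boxes_to_infinity (\<lambda>(L, M, N). ereal (maxtw_ratio L M N))" by simp
  moreover have "eventually (\<lambda>n. ereal (1 / 16 * (real n / (real n + 2))\<^sup>2) 
      \<le> ereal (maxtw_ratio (2 * n ^ 2 + 4 * n) (n ^ 3 + 2 * n ^ 2) (4 * n))) sequentially"
    using eventually_ge_at_top[of 2] by eventually_elim (use maxtw_ratio_tubes in simp)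
  then have "Limsup sequentially (\<lambda>n. ereal (1 / 16 * (real n / (real n + 2))\<^sup>2))
    \<le> Limsup sequentially (\<lambda>n. ereal (maxtw_ratio (2 * n ^ 2 + 4 * n) (n ^ 3 + 2 * n ^ 2) (4 * n)))"
    by (rule Limsup_mono)
  moreover have "(\<lambda>n. ereal (1 / 16 * (real n / (real n + 2))\<^sup>2)) \<longlonglongrightarrow> ereal (1 / 16)"
    unfolding lim_ereal by real_asymp
  then have "Limsup sequentially (\<lambda>n. ereal (1 / 16 * (real n / (real n + 2))\<^sup>2)) = ereal (1 / 16)"
    by (rule lim_imp_Limsup[OF sequentially_bot])
  ultimately show "ereal (1 / 16) \<le> Limsup boxes_to_infinity (\<lambda>(L, M, N). ereal (maxtw_ratio L M N))"
    by simp
qed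

text \<open>Cubes of even side are admissible boxes that tend to infinity, and their ratio never
  exceeds 1/24.\<close>

lemma Liminf_maxtw_ratio:
  "Liminf boxes_to_infinity (\<lambda>(L, M, N). ereal (maxtw_ratio L M N)) \<le> ereal (1 / 24)"
proof -
  have "filterlim (\<lambda>n. 2 * n) at_top (sequentially :: nat filter)"
    by (rule filterlim_at_top_mono[OF filterlim_ident]) auto
  then have "filterlim (\<lambda>n. (2 * n, 2 * n, 2 * n)) boxes_to_infinity sequentially"
    by (intro filterlim_boxes_to_infinity) auto
  from Liminf_subfilter[OF this, of "\<lambda>(L, M, N). ereal (maxtw_ratio L M N)"]
  have "Liminf boxes_to_infinity (\<lambda>(L, M, N). ereal (maxtw_ratio L M N))
    \<le> Liminf sequentially (\<lambda>n. ereal (maxtw_ratio (2 * n) (2 * n) (2 * n)))" by simp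
  also have "\<dots> \<le> Limsup sequentially (\<lambda>n. ereal (maxtw_ratio (2 * n) (2 * n) (2 * n)))"
    by (rule Liminf_le_Limsup) simp
  also have "\<dots> \<le> ereal (1 / 24)"
  proof (rule Limsup_bounded)
    show "eventually (\<lambda>n. ereal (maxtw_ratio (2 * n) (2 * n) (2 * n)) \<le> ereal (1 / 24)) sequentially"
      using eventually_gt_at_top[of 0]
    proof eventually_elim
      fix n :: nat assume "0 < n"
      then show "ereal (maxtw_ratio (2 * n) (2 * n) (2 * n)) \<le> ereal (1 / 24)"
        using maxtw_upper_cube[of "2 * n"] by (simp only: ereal_less_eq) (intro maxtw_ratio_le; simp)
    qed
  qed
  finally show ?thesis .
qed

theorem theorem1p4:
  "(\<forall>L M N :: nat.
      2 \<le> L \<and> 2 \<le> M \<and> 2 \<le> N \<and>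
      (2 < L \<and> 2 < M \<or> 2 < L \<and> 2 < N \<or> 2 < M \<and> 2 < N) \<and>
      (even L \<or> even M \<or> even N) \<longrightarrow>
      1 / 162 * real (L * M * N * min L (min M N)) \<le> maxtw L M N \<and>
      maxtw L M N \<le> 1 / 16 * real (L * M * N * min L (min M N))) \<and>
   Limsup boxes_to_infinity (\<lambda>(L, M, N). ereal (maxtw_ratio L M N)) = ereal (1 / 16) \<and>
   Liminf boxes_to_infinity (\<lambda>(L, M, N). ereal (maxtw_ratio L M N)) \<le> ereal (1 / 24)"
proof (intro conjI allI impI)
  fix L M N :: nat
  assume *: "2 \<le> L \<and> 2 \<le> M \<and> 2 \<le> N \<and>
      (2 < L \<and> 2 < M \<or> 2 < L \<and> 2 < N \<or> 2 < M \<and> 2 < N) \<and>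
      (even L \<or> even M \<or> even N)"
  then have pos: "0 < L" "0 < M" "0 < N" and ev: "even (L * M * N)" by auto
  obtain k where k: "attains L M N k" "4 * int (L * M * N * min L (min M N)) \<le> 162 * k"
    using large_twist[of L M N] * unfolding large_twist_def by blast
  have "real_of_int (4 * int (L * M * N * min L (min M N))) \<le> real_of_int (162 * k)"
    using k(2) by (simp only: of_int_le_iff)
  then show "1 / 162 * real (L * M * N * min L (min M N)) \<le> maxtw L M N"
    using maxtw_lower[OF pos k(1)] by simp
  show "maxtw L M N \<le> 1 / 16 * real (L * M * N * min L (min M N))"
    by (rule maxtw_upper[OF pos ev])
qed (rule Limsup_maxtw_ratio Liminf_maxtw_ratio)+

end
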